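(* Let $d\ge2$. There exist positive constants $c_{d,1},c_{d,2},c_{d,3}$ (depending only on $d$) such that for every $\ell\ge1$ the following hold. 1. For all integers $q_1,q_2\ge2$, $$\int_{(\mathbb S^d)^3}G_{\ell;d}(\langle x_1,x_2\rangle)G_{\ell;d}(\langle x_1,x_3\rangle)^{q_1}G_{\ell;d}(\langle x_2,x_3\rangle)^{q_2}dx_1dx_2dx_3=c_{d,1}\prod_{i=1}^2\int_{(\mathbb S^d)^2}G_{\ell;d}(\langle x,y\rangle)^{q_i+1}dxdy.$$ 2. For all integers $q_1,q_2\ge2$ and $q_3\ge1$, $$\int_{(\mathbb S^d)^4}G_{\ell;d}(\langle x_1,x_2\rangle)G_{\ell;d}(\langle x_1,x_4\rangle)^{q_1}G_{\ell;d}(\langle x_2,x_3\rangle)^{q_2}G_{\ell;d}(\langle x_3,x_4\rangle)^{q_3}dx_1dx_2dx_3dx_4=c_{d,2}\prod_{i=1}^3\int_{(\mathbb S^d)^2}G_{\ell;d}(\langle x,y\rangle)^{q_i+1}dxdy.$$ 3. For all integers $q_1,q_2\ge2$ and $q_3\ge0$, $$\int_{(\mathbb S^d)^4}G_{\ell;d}(\langle x_1,x_2\rangle)G_{\ell;d}(\langle x_1,x_4\rangle)^{q_1}G_{\ell;d}(\langle x_2,x_3\rangle)^{q_2}G_{\ell;d}(\langle x_2,x_4\rangle)^{q_3}G_{\ell;d}(\langle x_3,x_4\rangle)dx_1dx_2dx_3dx_4$$ $$=c_{d,3}\int_{(\mathbb S^d)^2}G_{\ell;d}(\langle x,y\rangle)^{q_1+1}dxdy\int_{(\mathbb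 S^d)^2}G_{\ell;d}(\langle x,y\rangle)^{q_2+1}dxdy\int_{(\mathbb S^d)^2}G_{\ell;d}(\langle x,y\rangle)^{q_3+2}dxdy.$$
   Context: $\mathbb S^d\subset\mathbb R^{d+1}$ is the unit sphere with surface measure $dx$. $G_{\ell;d}$ is the Gegenbauer polynomial of degree $\ell$ normalized by $G_{\ell;d}(1)=1$, i.e. the polynomials $(G_{\ell;d})_\ell$ are orthogonal on $[-1,1]$ with respect to the weight $(1-t^2)^{d/2-1}$; equivalently $G_{\ell;d}(\langle x,y\rangle)=\frac{\mu_d}{n_{\ell;d}}\sum_{m=1}^{n_{\ell;d}}Y_{\ell,m;d}(x)Y_{\ell,m;d}(y)$, where $(Y_{\ell,m;d})_{m=1}^{n_{\ell;d}}$ is a real orthonormal basis of the eigenspace of the Laplace–Beltrami operator on $\mathbb S^d$ with eigenvalue $-\ell(\ell+d-1)$, $n_{\ell;d}$ is its dimension and $\mu_d=\int_{\mathbb S^d}dx$. *)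

theory Defs
  imports "HOL-Analysis.Analysis" "HOL-Computational_Algebra.Polynomial"
begin

section \<open>Surface measure of the unit sphere\<close>

text \<open>
  The surface measure of the unit sphere of an \<open>n\<close>-dimensional Euclidean space is defined by the
  cone formula: the measure of \<open>A\<close> is \<open>n\<close> times the Lebesgue measure of the cone
  \<open>{r *\<^sub>R x | 0 < r \<le> 1, x \<in> A}\<close>. It is not normalised to a probability measure; its total mass is
  \<open>n * unit_ball_vol n\<close>.
\<close>

definition surface_measure :: "'a::euclidean_space measure" where
  "surface_measure =
     scale_measure (of_nat DIM('a))
       (distr (restrict_space lborel (cball 0 1 - {0})) (restrict_space borel (sphere 0 1))
         (\<lambda>x. x /\<^sub>R norm x))"

lemma space_surface_measure: "space (surface_measure :: 'a::euclidean_space measure) = sphere 0 1"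
  by (simp add: surface_measure_def space_restrict_space space_scale_measure)

lemma sets_surface_measure:
  "sets (surface_measure :: 'a::euclidean_space measure) = sets (restrict_space borel (sphere 0 1))"
  by (simp add: surface_measure_def)

lemma measurable_radial_projection:
  "(\<lambda>x::'a::euclidean_space. x /\<^sub>R norm x) \<in>
     restrict_space lborel (cball 0 1 - {0}) \<rightarrow>\<^sub>M restrict_space borel (sphere 0 1)"
proof (rule measurable_restrict_space2)
  show "(\<lambda>x::'a. x /\<^sub>R norm x) \<in> space (restrict_space lborel (cball 0 1 - {0})) \<rightarrow> sphere 0 1"
    by (auto simp: space_restrict_space)
  show "(\<lambda>x::'a. x /\<^sub>R norm x) \<in> restrict_space lborel (cball 0 1 - {0}) \<rightarrow>\<^sub>M borel"
    by (rule measurable_restrict_space1) measurable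
qed

lemma emeasure_surface_measure:
  assumes "A \<in> sets (restrict_space borel (sphere (0::'a::euclidean_space) 1))"
  shows "emeasure surface_measure A =
    of_nat DIM('a) * emeasure lborel {r *\<^sub>R x | r x. 0 < r \<and> r \<le> 1 \<and> x \<in> A}"
proof -
  have sub: "A \<subseteq> sphere 0 1"
    using assms by (auto simp: sets_restrict_space)
  have "(\<lambda>x. x /\<^sub>R norm x) -` A \<inter> (cball 0 1 - {0}) = {r *\<^sub>R x | r x. 0 < r \<and> r \<le> 1 \<and> x \<in> A}"
    (is "?L = ?R")
  proof (intro subset_antisym subsetI)
    fix y assume y: "y \<in> ?L"
    then have "y = norm y *\<^sub>R (y /\<^sub>R norm y)" by simp
    then show "y \<in> ?R" using y by fastforce
  next
    fix y assume "y \<in> ?R"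
    then obtain r x where rx: "0 < r" "r \<le> 1" "x \<in> A" "y = r *\<^sub>R x" by blast
    then have "norm x = 1" using sub by auto
    then show "y \<in> ?L" using rx by auto
  qed
  moreover from this have "?R \<subseteq> cball 0 1 - {0}" by blast
  ultimately show ?thesis
    using assms
    by (simp add: surface_measure_def emeasure_distr[OF measurable_radial_projection]
        emeasure_restrict_space space_restrict_space)
qed

lemma emeasure_surface_measure_space:
  "emeasure (surface_measure :: 'a::euclidean_space measure) (sphere 0 1) =
     ennreal (real DIM('a) * unit_ball_vol (real DIM('a)))"
proof -
  have S: "sphere (0::'a) 1 \<in> sets (restrict_space borel (sphere 0 1))"
    by (auto simp: sets_restrict_space intro!: image_eqI[of _ _ UNIV])
  have "emeasure lborel (cball (0::'a) 1 - {0}) = emeasure lborel (cball (0::'a) 1)"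
    by (subst emeasure_Diff) auto
  also have "\<dots> = ennreal (unit_ball_vol (real DIM('a)))"
    by (subst emeasure_cball) auto
  finally have "emeasure lborel (cball (0::'a) 1 - {0}) = ennreal (unit_ball_vol (real DIM('a)))" .
  moreover have "(\<lambda>x. x /\<^sub>R norm x) -` sphere 0 1 \<inter> (cball 0 1 - {0}) = cball (0::'a) 1 - {0}"
    by auto
  ultimately show ?thesis
    using S
    by (simp add: surface_measure_def emeasure_distr[OF measurable_radial_projection]
        emeasure_restrict_space space_restrict_space ennreal_mult ennreal_of_nat_eq_real_of_nat)
qed

section \<open>Gegenbauer polynomials\<close>

definition gegenbauer_family :: "nat \<Rightarrow> (nat \<Rightarrow> real poly) \<Rightarrow> bool" where
  "gegenbauer_family d G \<longleftrightarrow>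
     (\<forall>l. degree (G l) = l \<and> poly (G l) 1 = 1) \<and>
     (\<forall>k l. k \<noteq> l \<longrightarrow>
       (LINT t:{-1..1}|lborel.
          poly (G k) t * poly (G l) t * (1 - t\<^sup>2) powr (real d / 2 - 1)) = 0)"

definition gegenbauer :: "nat \<Rightarrow> nat \<Rightarrow> real poly" where
  "gegenbauer d = (THE G. gegenbauer_family d G)"

text \<open>For \<open>d \<ge> 2\<close> the description is well defined, see \<open>ex1_gegenbauer_family\<close>.\<close>

definition weighted_inner :: "nat \<Rightarrow> real poly \<Rightarrow> real poly \<Rightarrow> real" where
  "weighted_inner d p q =
     (LINT t:{-1..1}|lborel. poly p t * poly q t * (1 - t\<^sup>2) powr (real d / 2 - 1))"

lemma set_integrable_poly_weight:
  assumes "2 \<le> d"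
  shows "set_integrable lborel {-1..1} (\<lambda>t. poly p t * (1 - t\<^sup>2) powr (real d / 2 - 1))"
proof (rule set_integrable_bound)
  show "set_integrable lborel {-1..1} (poly p)"
    by (intro borel_integrable_atLeastAtMost' continuous_intros)
  have [measurable]: "poly p \<in> borel_measurable borel"
    by (intro borel_measurable_continuous_onI continuous_intros)
  show "set_borel_measurable lborel {-1..1} (\<lambda>t. poly p t * (1 - t\<^sup>2) powr (real d / 2 - 1))"
    unfolding set_borel_measurable_def by measurable
  have "(1 - t\<^sup>2) powr (real d / 2 - 1) \<le> 1" if "t \<in> {-1..1}" for t :: real
  proof -
    have "t\<^sup>2 \<le> 1" using that by (simp add: abs_square_le_1 abs_le_iff)
    then show ?thesis using assms by (intro powr_le1) auto
  qed
  then show "AE t in lborel. t \<in> {-1..1} \<longrightarrow>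
      norm (poly p t * (1 - t\<^sup>2) powr (real d / 2 - 1)) \<le> norm (poly p t)"
    by (intro AE_I2) (auto simp: abs_mult intro!: mult_left_le)
qed

lemma weighted_inner_commute: "weighted_inner d p q = weighted_inner d q p"
  by (simp add: weighted_inner_def mult.commute)

lemma weighted_inner_mult: "weighted_inner d p (q * r) = weighted_inner d (p * q) r"
  by (simp add: weighted_inner_def mult.assoc)

lemma weighted_inner_smult:
  "weighted_inner d (smult c p) q = c * weighted_inner d p q"
  "weighted_inner d p (smult c q) = c * weighted_inner d p q"
proof -
  show "weighted_inner d (smult c p) q = c * weighted_inner d p q" for p q
    by (simp add: weighted_inner_def mult.assoc)
  then show "weighted_inner d p (smult c q) = c * weighted_inner d p q"
    by (metis weighted_inner_commute)
qed

lemma weighted_inner_zero: "weighted_inner d 0 q = 0" "weighted_inner d p 0 = 0"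
  by (simp_all add: weighted_inner_def)

lemma weighted_inner_add:
  assumes "2 \<le> d"
  shows "weighted_inner d p (q + r) = weighted_inner d p q + weighted_inner d p r"
proof -
  note I = set_integrable_poly_weight[OF assms]
  show ?thesis
    using set_integral_add(2)[OF I[of "p * q"] I[of "p * r"]]
    by (simp add: weighted_inner_def algebra_simps)
qed

lemma weighted_inner_diff:
  assumes "2 \<le> d"
  shows "weighted_inner d p (q - r) = weighted_inner d p q - weighted_inner d p r"
  using weighted_inner_add[OF assms, of p "q - r" r] by simp

lemma weighted_inner_sum:
  assumes "2 \<le> d" "finite A"
  shows "weighted_inner d p (\<Sum>a\<in>A. f a) = (\<Sum>a\<in>A. weighted_inner d p (f a))"
  using assms(2)
  by (induction rule: finite_induct) (simp_all add: weighted_inner_zero weighted_inner_add[OF assms(1)])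

lemma weighted_inner_pos:
  assumes d: "2 \<le> d" and ne: "p * q \<noteq> 0"
    and nn: "\<And>t. t \<in> {-1..1} \<Longrightarrow> 0 \<le> poly p t * poly q t"
  shows "0 < weighted_inner d p q"
proof -
  define f where "f t = indicat_real {-1..1} t * (poly (p * q) t * (1 - t\<^sup>2) powr (real d / 2 - 1))"
    for t
  have int: "integrable lborel f"
    using set_integrable_poly_weight[OF d, of "p * q"]
    by (simp add: set_integrable_def f_def[abs_def])
  have f0: "AE t in lborel. 0 \<le> f t"
    using nn by (intro AE_I2) (auto simp: f_def indicator_def)
  have eq: "weighted_inner d p q = integral\<^sup>L lborel f"
    by (simp add: weighted_inner_def set_lebesgue_integral_def f_def[abs_def])
  have "integral\<^sup>L lborel f \<noteq> 0"
  proof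
    assume "integral\<^sup>L lborel f = 0"
    then have "AE t in lborel. f t = 0"
      using integral_nonneg_eq_0_iff_AE[OF int f0] by simp
    moreover have "AE t in lborel. t \<notin> {t. poly (p * q) t = 0}"
      using poly_roots_finite[OF ne] by (intro AE_not_in finite_imp_null_set_lborel)
    ultimately have "AE t in lborel. t \<notin> {-1<..<1::real}"
    proof eventually_elim
      case (elim t)
      show ?case
      proof
        assume t: "t \<in> {-1<..<1::real}"
        then have "t\<^sup>2 < 1" by (simp add: abs_square_less_1 abs_less_iff)
        then show False using elim t by (auto simp: f_def)
      qed
    qed
    then have "emeasure lborel {-1<..<1::real} = 0"
      by (subst (asm) AE_iff_measurable[of "{-1<..<1::real}"]) auto
    then show False by simp
  qed
  moreover have "0 \<le> integral\<^sup>L lborel f"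
    using f0 by (rule integral_nonneg_AE)
  ultimately show ?thesis using eq by simp
qed

lemma weighted_inner_orthogonal_lower:
  assumes d: "2 \<le> d" and deg: "\<And>k. k < n \<Longrightarrow> degree (G k) = k \<and> G k \<noteq> 0"
    and orth: "\<And>k. k < n \<Longrightarrow> weighted_inner d p (G k) = 0"
    and q: "q = 0 \<or> degree q < n"
  shows "weighted_inner d p q = 0"
  using q
proof (induction "if q = 0 then 0 else Suc (degree q)" arbitrary: q rule: less_induct)
  case less
  show ?case
  proof (cases "q = 0")
    case False
    define m c r where "m = degree q" and "c = lead_coeff q / lead_coeff (G m)"
      and "r = q - smult c (G m)"
    have m: "m < n" using less.prems False m_def by simp
    have G: "degree (G m) = m" "coeff (G m) m \<noteq> 0"
      using deg[OF m] by (auto dest: leading_coeff_neq_0)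
    have "coeff r m = 0" using G by (simp add: r_def c_def m_def)
    moreover have "degree r \<le> m"
      using G by (auto simp: r_def m_def intro!: degree_diff_le order.trans[OF degree_smult_le])
    ultimately have r: "r = 0 \<or> degree r < m"
      by (metis leading_coeff_0_iff le_neq_implies_less)
    then have "weighted_inner d p r = 0"
      using m False by (intro less.hyps) (auto simp: m_def)
    moreover have "q = r + smult c (G m)" by (simp add: r_def)
    ultimately show ?thesis
      by (simp add: weighted_inner_add[OF d] weighted_inner_smult orth[OF m])
  qed (simp add: weighted_inner_zero)
qed

lemma gegenbauer_family_iff:
  "gegenbauer_family d G \<longleftrightarrow>
     (\<forall>l. degree (G l) = l \<and> poly (G l) 1 = 1) \<and>
     (\<forall>k l. k \<noteq> l \<longrightarrow> weighted_inner d (G k) (G l) = 0)"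
  by (simp add: gegenbauer_family_def weighted_inner_def)

lemma ex_gegenbauer_family:
  assumes d: "2 \<le> d"
  shows "\<exists>G. gegenbauer_family d G"
proof -
  define P where "P n p \<longleftrightarrow> degree p = n \<and> poly p 1 = 1 \<and>
    (\<forall>q. q = 0 \<or> degree q < n \<longrightarrow> weighted_inner d p q = 0)" for n p
  have "\<exists>p. P n p" for n
  proof (induction n rule: less_induct)
    case (less n)
    then obtain G where G: "\<And>k. k < n \<Longrightarrow> P k (G k)" by metis
    have degG: "degree (G k) = k \<and> G k \<noteq> 0" if "k < n" for k
      using G[OF that] by (auto simp: P_def)
    have GG: "weighted_inner d (G k) (G j) = 0" if "k < n" "j < n" "k \<noteq> j" for k j
    proof (cases "k < j")
      case True
      then show ?thesis using G[of j] degG that P_def weighted_inner_commute by metis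
    next
      case False
      then have "j < k" using that by simp
      then show ?thesis using G[of k] degG that P_def by metis
    qed
    have Gpos: "weighted_inner d (G k) (G k) \<noteq> 0" if "k < n" for k
      using weighted_inner_pos[OF d, of "G k" "G k"] degG[OF that] by auto
    define X :: "real poly" where "X = monom 1 n"
    define s where
      "s = (\<Sum>k<n. smult (weighted_inner d X (G k) / weighted_inner d (G k) (G k)) (G k))"
    define p where "p = X - s"
    have "coeff s n = 0"
      using degG by (auto simp: s_def coeff_sum intro!: sum.neutral coeff_eq_0)
    then have cp: "coeff p n = 1" by (simp add: p_def X_def)
    have "degree s \<le> n"
      unfolding s_def using degG
      by (intro degree_sum_le) (auto intro!: order.trans[OF degree_smult_le] less_imp_le)
    then have "degree p \<le> n"
      by (auto simp: p_def X_def intro!: degree_diff_le degree_monom_le)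
    with cp have dp: "degree p = n" by (metis le_antisym le_degree zero_neq_one)
    have pG: "weighted_inner d p (G j) = 0" if j: "j < n" for j
    proof -
      have "weighted_inner d (G j) s = (\<Sum>k<n. if k = j then weighted_inner d X (G j) else 0)"
        unfolding s_def weighted_inner_sum[OF d finite_lessThan] weighted_inner_smult
        using GG Gpos j by (intro sum.cong) auto
      then show ?thesis
        using j by (subst weighted_inner_commute)
          (simp add: p_def weighted_inner_diff[OF d] weighted_inner_commute[of d "G j" X])
    qed
    have low: "weighted_inner d p q = 0" if "q = 0 \<or> degree q < n" for q
      using weighted_inner_orthogonal_lower[OF d degG pG that] .
    have p1: "poly p 1 \<noteq> 0"
    proof
      assume "poly p 1 = 0"
      then obtain q where q: "p = [:-1, 1:] * q" by (auto simp: poly_eq_0_iff_dvd elim: dvdE)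
      have p0: "p \<noteq> 0" using cp by auto
      then have q0: "q \<noteq> 0" using q by auto
      then have "degree p = Suc (degree q)" unfolding q by (subst degree_mult_eq) auto
      then have "weighted_inner d p q = 0" using low dp by auto
      moreover have "0 < weighted_inner d (- p) q"
      proof (rule weighted_inner_pos[OF d])
        show "- p * q \<noteq> 0" using p0 q0 by simp
        fix t :: real assume t: "t \<in> {-1..1}"
        have "poly (- p) t * poly q t = (1 - t) * (poly q t)\<^sup>2"
          by (simp add: q power2_eq_square algebra_simps)
        then show "0 \<le> poly (- p) t * poly q t" using t by simp
      qed
      moreover have "weighted_inner d (- p) q = - weighted_inner d p q"
        using weighted_inner_smult(1)[of d "-1" p q] by simp
      ultimately show False by simp
    qed
    have "P n (smult (1 / poly p 1) p)"
      using p1 dp low by (auto simp: P_def weighted_inner_smult)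
    then show ?case ..
  qed
  then obtain G where G: "\<And>n. P n (G n)" by metis
  have "weighted_inner d (G k) (G l) = 0" if "k \<noteq> l" for k l
    using G[of k] G[of l] that unfolding P_def
    by (metis linorder_neqE_nat weighted_inner_commute)
  then have "gegenbauer_family d G"
    using G by (auto simp: gegenbauer_family_iff P_def)
  then show ?thesis by blast
qed

lemma gegenbauer_family_unique:
  assumes d: "2 \<le> d" and G: "gegenbauer_family d G" and H: "gegenbauer_family d H"
  shows "G = H"
proof
  fix l
  have "degree (G l) = l" "poly (G l) 1 = 1" "degree (H l) = l" "poly (H l) 1 = 1"
    using G H by (auto simp: gegenbauer_family_iff)
  note GH = this
  have nz: "G l \<noteq> 0" "H l \<noteq> 0" using GH by auto
  define a where "a = lead_coeff (G l) / lead_coeff (H l)"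
  define r where "r = G l - smult a (H l)"
  have "coeff r l = 0" using GH nz by (simp add: r_def a_def) (metis leading_coeff_0_iff)
  moreover have "degree r \<le> l"
    using GH by (auto simp: r_def intro!: degree_diff_le order.trans[OF degree_smult_le])
  ultimately have r: "r = 0 \<or> degree r < l"
    by (metis leading_coeff_0_iff le_neq_implies_less)
  have low: "weighted_inner d (F l) r = 0" if F: "gegenbauer_family d F" for F
  proof (rule weighted_inner_orthogonal_lower[OF d _ _ r])
    show "degree (F k) = k \<and> F k \<noteq> 0" if "k < l" for k
      using F unfolding gegenbauer_family_iff by (metis poly_0 zero_neq_one)
    show "weighted_inner d (F l) (F k) = 0" if "k < l" for k
      using F that unfolding gegenbauer_family_iff by auto
  qed
  have "weighted_inner d r r = 0"
    using low[OF G] low[OF H] weighted_inner_commute[of d r]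
    by (subst (2) r_def) (simp add: weighted_inner_diff[OF d] weighted_inner_smult)
  then have "r = 0"
    using weighted_inner_pos[OF d, of r r] by auto
  then have "G l = smult a (H l)" by (simp add: r_def)
  moreover from this have "a = 1" using GH by simp
  ultimately show "G l = H l" by simp
qed

lemma ex1_gegenbauer_family: "2 \<le> d \<Longrightarrow> \<exists>!G. gegenbauer_family d G"
  using ex_gegenbauer_family gegenbauer_family_unique by blast

lemma gegenbauer_family_gegenbauer: "2 \<le> d \<Longrightarrow> gegenbauer_family d (gegenbauer d)"
  unfolding gegenbauer_def by (rule theI'[OF ex1_gegenbauer_family])

end

theory Submission
  imports Defs
begin

text \<open>
  By the Funk--Hecke formula, a spherical convolution \<open>\<integral> p(x \<bullet> y) G(x \<bullet> z) dx\<close> with the Gegenbauer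
  polynomial \<open>G\<close> equals \<open>\<lambda> G(y \<bullet> z)\<close> with \<open>\<lambda> = \<integral> p(x \<bullet> y) G(x \<bullet> y) dx\<close>. For \<open>p = G\<^sup>q\<close> this makes
  \<open>\<lambda>\<close> the double integral of \<open>G\<^bsup>q+1\<^esup>\<close> divided by the total mass \<open>\<mu>\<close>, and integrating out one vertex
  at a time gives the three identities with \<open>c\<^sub>1 = 1/\<mu>\<close> and \<open>c\<^sub>2 = c\<^sub>3 = 1/\<mu>\<^sup>2\<close>. Rotation invariance makes
  the convolution a polynomial in \<open>y \<bullet> z\<close>, and it also yields the two-term moment recurrence of
  the zonal measure, which is the one that integration by parts gives for \<open>(1 - t\<^sup>2)\<^bsup>d/2-1\<^esup>\<close>.
\<close>

section \<open>Orthogonal invariance\<close>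

lemma nn_integral_lborel_shift:
  fixes f :: "'a::euclidean_space \<Rightarrow> ennreal"
  assumes [measurable]: "f \<in> borel_measurable borel"
  shows "(\<integral>\<^sup>+x. f (a + x) \<partial>lborel) = (\<integral>\<^sup>+x. f x \<partial>lborel)"
proof -
  have "(\<integral>\<^sup>+x. f x \<partial>lborel) = (\<integral>\<^sup>+x. f x \<partial>distr lborel borel ((+) a))"
    by (simp add: lborel_distr_plus)
  then show ?thesis
    by (simp add: nn_integral_distr)
qed

text \<open>For the unit ball \<open>B\<close>, evaluating \<open>\<integral>\<integral> 1\<^sub>B(y) 1\<^sub>A(T x + y) dx dy\<close> in both orders gives
  \<open>vol B * vol (T\<^sup>-\<^sup>1 A) = vol B * vol A\<close>, because \<open>T\<close> preserves distances. The library version needs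
  a well-ordered index type.\<close>
lemma emeasure_lborel_vimage_orthogonal:
  fixes T :: "'a::euclidean_space \<Rightarrow> 'a"
  assumes T: "orthogonal_transformation T" and A[measurable]: "A \<in> sets borel"
  shows "emeasure lborel (T -` A) = emeasure lborel A"
proof -
  define B where "B = ball (0::'a) 1"
  define T' where "T' = inv T"
  have T': "orthogonal_transformation T'"
    unfolding T'_def by (rule orthogonal_transformation_inv[OF T])
  have TT': "T (T' y) = y" for y
    unfolding T'_def by (rule surj_f_inv_f[OF orthogonal_transformation_surj[OF T]])
  have lin: "linear T" using T by (rule orthogonal_transformation_linear)
  have Tm[measurable]: "T \<in> borel_measurable borel"
    by (intro borel_measurable_continuous_onI linear_continuous_on linear_conv_bounded_linear[THEN iffD1] lin)
  have Bm[measurable]: "B \<in> sets borel" by (simp add: B_def)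
  have vB: "emeasure lborel (ball c 1) = emeasure lborel B" for c :: 'a
    unfolding B_def by (simp add: emeasure_ball)
  have "emeasure lborel B * emeasure lborel (T -` A)
      = (\<integral>\<^sup>+y. \<integral>\<^sup>+x. indicator B y * indicator A (T x + y) \<partial>lborel \<partial>lborel)"
  proof -
    have "(\<integral>\<^sup>+x. indicator B y * indicator A (T x + y) \<partial>lborel)
        = indicator B y * emeasure lborel (T -` A)" for y
    proof -
      \<comment> \<open>The translation by \<open>y\<close> is pulled inside \<open>T\<close>, where
        translation invariance in \<open>x\<close> removes it.\<close>
      have "T x + y = T (T' y + x)" for x
        by (simp add: linear_add[OF lin] TT' add.commute)
      then have "(\<integral>\<^sup>+x. indicator A (T x + y) \<partial>lborel) = (\<integral>\<^sup>+x. indicator A (T (T' y + x)) \<partial>lborel)"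
        by simp
      also have "\<dots> = (\<integral>\<^sup>+x. indicator A (T x) \<partial>lborel)"
        by (rule nn_integral_lborel_shift) measurable
      also have "\<dots> = (\<integral>\<^sup>+x. indicator (T -` A) x \<partial>lborel)"
        by (simp add: indicator_def)
      also have "\<dots> = emeasure lborel (T -` A)"
        using measurable_sets[OF Tm A] by simp
      finally show ?thesis by (simp add: nn_integral_cmult)
    qed
    then show ?thesis by (simp add: nn_integral_multc)
  qed
  also have "\<dots> = (\<integral>\<^sup>+x. \<integral>\<^sup>+y. indicator B y * indicator A (T x + y) \<partial>lborel \<partial>lborel)"
    by (rule lborel_pair.Fubini') measurable
  also have "\<dots> = (\<integral>\<^sup>+x. \<integral>\<^sup>+y. indicator B (y - T x) * indicator A y \<partial>lborel \<partial>lborel)"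
  proof (rule nn_integral_cong)
    fix x
    show "(\<integral>\<^sup>+y. indicator B y * indicator A (T x + y) \<partial>lborel)
        = (\<integral>\<^sup>+y. indicator B (y - T x) * indicator A y \<partial>lborel)"
      by (subst nn_integral_lborel_shift[of _ "T x", symmetric]) auto
  qed
  also have "\<dots> = (\<integral>\<^sup>+y. \<integral>\<^sup>+x. indicator B (y - T x) * indicator A y \<partial>lborel \<partial>lborel)"
    by (rule lborel_pair.Fubini') measurable
  also have "\<dots> = (\<integral>\<^sup>+y. emeasure lborel B * indicator A y \<partial>lborel)"
  proof (rule nn_integral_cong)
    fix y
    \<comment> \<open>Preservation of distances enters here: the points \<open>x\<close> with
      \<open>T x\<close> at distance less than 1 from \<open>y\<close> form the unit ball about
      \<open>T' y\<close>.\<close>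
    have "norm (y - T x) = norm (T' y - x)" for x
      using orthogonal_transformation_norm[OF T, of "T' y - x"] by (simp add: linear_diff[OF lin] TT')
    then have "y - T x \<in> B \<longleftrightarrow> x \<in> ball (T' y) 1" for x
      unfolding B_def by (metis dist_norm mem_ball mem_ball_0)
    then have "(indicator B (y - T x) :: ennreal) = indicator (ball (T' y) 1) x" for x
      by (simp add: indicator_def)
    then have "(\<integral>\<^sup>+x. indicator B (y - T x) \<partial>lborel) = emeasure lborel B"
      by (simp add: vB)
    then show "(\<integral>\<^sup>+x. indicator B (y - T x) * indicator A y \<partial>lborel) = emeasure lborel B * indicator A y"
      by (simp add: nn_integral_multc)
  qed
  also have "\<dots> = emeasure lborel B * emeasure lborel A"
    by (simp add: nn_integral_cmult)
  finally have eq: "emeasure lborel B * emeasure lborel (T -` A) = emeasure lborel B * emeasure lborel A" .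
  have "emeasure lborel B \<noteq> 0" "emeasure lborel B \<noteq> \<infinity>"
    using unit_ball_vol_pos[of "real DIM('a)"] by (simp_all add: B_def emeasure_ball less_imp_neq[symmetric])
  with eq show ?thesis by (simp add: ennreal_mult_cancel_left)
qed

text \<open>Since \<open>T\<close> is linear and preserves norms, it commutes with the radial
  projection and preserves the punctured unit ball. The cone over the preimage of \<open>A\<close>
  is therefore the preimage of the cone over \<open>A\<close>, and the invariance of Lebesgue
  measure applies.\<close>

lemma distr_surface_measure_orthogonal:
  fixes T :: "'a::euclidean_space \<Rightarrow> 'a"
  assumes T: "orthogonal_transformation T"
  shows "T \<in> surface_measure \<rightarrow>\<^sub>M surface_measure"
    and "distr surface_measure surface_measure T = surface_measure"
proof -
  let ?R = "restrict_space borel (sphere (0::'a) 1)"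
  let ?p = "\<lambda>x::'a. x /\<^sub>R norm x" and ?D = "cball (0::'a) 1 - {0}"
  have lin: "linear T" using T by (rule orthogonal_transformation_linear)
  have nT: "norm (T x) = norm x" for x by (rule orthogonal_transformation_norm[OF T])
  have Tm: "T \<in> borel_measurable borel"
    by (intro borel_measurable_continuous_onI linear_continuous_on linear_conv_bounded_linear[THEN iffD1] lin)
  have "T \<in> ?R \<rightarrow>\<^sub>M ?R"
    by (rule measurable_restrict_space2)
      (auto simp: space_restrict_space nT intro: measurable_restrict_space1 Tm)
  then show TR: "T \<in> surface_measure \<rightarrow>\<^sub>M surface_measure"
    by (simp add: measurable_cong_sets[OF sets_surface_measure sets_surface_measure])
  have pT: "?p (T x) = T (?p x)" for x
    by (simp add: nT linear_scale[OF lin])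
  have em: "emeasure surface_measure A = of_nat DIM('a) * emeasure lborel (?p -` A \<inter> ?D)"
    if "A \<in> sets ?R" for A
    using that by (simp add: surface_measure_def emeasure_distr[OF measurable_radial_projection]
        emeasure_restrict_space space_restrict_space)
  have Bor: "?p -` A \<inter> ?D \<in> sets borel" if "A \<in> sets ?R" for A
    using measurable_sets[OF measurable_radial_projection that]
    by (simp add: space_restrict_space sets_restrict_space_iff)
  show "distr surface_measure surface_measure T = surface_measure"
  proof (rule measure_eqI)
    fix A assume "A \<in> sets (distr surface_measure surface_measure T)"
    then have A: "A \<in> sets (surface_measure :: 'a measure)" "A \<in> sets ?R"
      by (simp_all add: sets_surface_measure)
    let ?A = "T -` A \<inter> sphere 0 1"
    have "?A \<in> sets ?R"
      using measurable_sets[OF TR A(1)] by (simp add: space_surface_measure sets_surface_measure)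
    moreover have "?p -` ?A \<inter> ?D = T -` (?p -` A \<inter> ?D)"
    proof (rule set_eqI)
      fix x
      have T0: "T x = 0 \<longleftrightarrow> x = 0"
        by (metis nT norm_eq_zero)
      have "norm (?p x) = 1" if "x \<noteq> 0"
        using that by simp
      then show "x \<in> ?p -` ?A \<inter> ?D \<longleftrightarrow> x \<in> T -` (?p -` A \<inter> ?D)"
        unfolding vimage_eq Int_iff Diff_iff singleton_iff mem_cball_0 mem_sphere_0 pT
        unfolding T0 nT by argo
    qed
    ultimately have "emeasure surface_measure ?A = emeasure surface_measure A"
      using emeasure_lborel_vimage_orthogonal[OF T Bor[OF A(2)]] A by (simp add: em)
    then show "emeasure (distr surface_measure surface_measure T) A = emeasure surface_measure A"
      by (simp add: emeasure_distr[OF TR A(1)] space_surface_measure)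
  qed simp
qed

lemma surface_integral_orthogonal:
  fixes f :: "'a::euclidean_space \<Rightarrow> real" and T :: "'a \<Rightarrow> 'a"
  assumes T: "orthogonal_transformation T" and f: "f \<in> borel_measurable surface_measure"
  shows "(LINT x|surface_measure. f (T x)) = (LINT x|surface_measure. f x)"
  using integral_distr[OF distr_surface_measure_orthogonal(1)[OF T] f]
  by (simp add: distr_surface_measure_orthogonal(2)[OF T])

section \<open>Reflections and the transitivity of orthogonal maps on pairs of vectors\<close>

text \<open>The Householder reflection in the hyperplane orthogonal to \<open>v\<close>; for
  \<open>v = 0\<close> it is the identity.\<close>

definition reflect :: "'a::euclidean_space \<Rightarrow> 'a \<Rightarrow> 'a" where
  "reflect v x = x - (2 * (x \<bullet> v) / (v \<bullet> v)) *\<^sub>R v"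

lemma orthogonal_transformation_reflect: "orthogonal_transformation (reflect v)"
  unfolding orthogonal_transformation_def
proof (intro conjI allI)
  show "linear (reflect v)"
    by (rule linearI)
      (simp_all add: reflect_def inner_add_left distrib_left add_divide_distrib scaleR_add_left
        scaleR_diff_right)
next
  fix x y
  define c where "c = 2 / (v \<bullet> v)"
  \<comment> \<open>This also holds at \<open>v = 0\<close>, where division by zero gives
    \<open>c = 0\<close>.\<close>
  have c: "c * c * (v \<bullet> v) = 2 * c" by (simp add: c_def)
  have r: "reflect v x = x - (c * (x \<bullet> v)) *\<^sub>R v" for x by (simp add: reflect_def c_def)
  have "reflect v x \<bullet> reflect v y
      = x \<bullet> y - 2 * c * ((x \<bullet> v) * (y \<bullet> v)) + (c * c * (v \<bullet> v)) * ((x \<bullet> v) * (y \<bullet> v))"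
    by (simp add: r inner_diff_left inner_diff_right inner_commute[of v y] algebra_simps)
  then show "reflect v x \<bullet> reflect v y = x \<bullet> y" by (simp add: c)
qed

lemma reflect_orthogonal: "x \<bullet> v = 0 \<Longrightarrow> reflect v x = x"
  by (simp add: reflect_def)

lemma reflect_self: "reflect v v = - v"
  by (simp add: reflect_def scaleR_2)

text \<open>Vectors of equal norm are mirror images in the hyperplane through the origin orthogonal
  to their difference.\<close>

lemma reflect_diff:
  assumes "norm x = norm y"
  shows "reflect (x - y) x = y"
proof (cases "x = y")
  case False
  have e: "x \<bullet> x = y \<bullet> y" using assms by (simp add: dot_square_norm)
  then have "(x - y) \<bullet> (x - y) = 2 * (x \<bullet> (x - y))"
    by (simp add: inner_simps inner_commute)
  moreover have "(x - y) \<bullet> (x - y) \<noteq> 0" using False by simp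
  ultimately show ?thesis by (simp add: reflect_def)
qed (simp add: reflect_def)

text \<open>Two reflections suffice: the first carries \<open>y\<close> to \<open>y'\<close>, the
  second carries the image \<open>z1\<close> of \<open>z\<close> to \<open>z'\<close>. The second
  fixes \<open>y'\<close>, since \<open>y'\<close> has the same inner product with \<open>z1\<close>
  and \<open>z'\<close> and so is orthogonal to \<open>z1 - z'\<close>.\<close>

lemma ex_orthogonal_transformation_pair:
  fixes y z y' z' :: "'a::euclidean_space"
  assumes "norm y = norm y'" "norm z = norm z'" "y \<bullet> z = y' \<bullet> z'"
  obtains T where "orthogonal_transformation T" "T y = y'" "T z = z'"
proof -
  define R where "R = reflect (y - y')"
  have R: "orthogonal_transformation R" "R y = y'"
    unfolding R_def by (simp_all add: orthogonal_transformation_reflect reflect_diff assms)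
  define z1 where "z1 = R z"
  have "norm z1 = norm z'" using R(1) assms by (simp add: z1_def orthogonal_transformation_norm)
  moreover have "y' \<bullet> z1 = y' \<bullet> z'"
    using R assms(3) unfolding z1_def orthogonal_transformation_def by metis
  ultimately have "(reflect (z1 - z') \<circ> R) y = y'" "(reflect (z1 - z') \<circ> R) z = z'"
    using R(2) by (simp_all add: reflect_orthogonal reflect_diff inner_simps flip: z1_def)
  then show thesis
    using that orthogonal_transformation_compose[OF orthogonal_transformation_reflect R(1)] by blast
qed

section \<open>Continuous functions on products of spheres\<close>

text \<open>A condition that is stable under products and makes continuous functions integrable.
  Measurability of the identity links the sigma-algebra of \<open>M\<close>, which may live on a
  proper subset of the type such as the sphere, to the Borel sets of the type.\<close>

definition compact_finite_borel :: "'a::{second_countable_topology, t2_space} measure \<Rightarrow> bool" where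
  "compact_finite_borel M \<longleftrightarrow>
     finite_measure M \<and> compact (space M) \<and> (\<lambda>x. x) \<in> borel_measurable M"

lemma compact_finite_borel_surface_measure:
  "compact_finite_borel (surface_measure :: 'a::euclidean_space measure)"
proof -
  have "finite_measure (surface_measure :: 'a measure)"
    by (rule finite_measureI) (simp add: space_surface_measure emeasure_surface_measure_space)
  moreover have "(\<lambda>x. x) \<in> borel_measurable (surface_measure :: 'a measure)"
    unfolding measurable_cong_sets[OF sets_surface_measure refl]
    by (intro measurable_restrict_space1) simp
  ultimately show ?thesis
    by (simp add: compact_finite_borel_def space_surface_measure)
qed

lemma compact_finite_borel_pair:
  assumes "compact_finite_borel M" "compact_finite_borel N"
  shows "compact_finite_borel (M \<Otimes>\<^sub>M N)"
proof -
  interpret M: finite_measure M using assms(1) by (simp add: compact_finite_borel_def)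
  interpret N: finite_measure N using assms(2) by (simp add: compact_finite_borel_def)
  have [measurable]: "(\<lambda>x. x) \<in> borel_measurable M" "(\<lambda>x. x) \<in> borel_measurable N"
    using assms by (simp_all add: compact_finite_borel_def)
  have "fst \<in> borel_measurable (M \<Otimes>\<^sub>M N)" "snd \<in> borel_measurable (M \<Otimes>\<^sub>M N)"
    using measurable_compose[OF measurable_fst, of "\<lambda>x. x" M borel N]
      measurable_compose[OF measurable_snd, of "\<lambda>x. x" N borel M] by simp_all
  then have "(\<lambda>x. (fst x, snd x)) \<in> borel_measurable (M \<Otimes>\<^sub>M N)"
    by (rule borel_measurable_Pair)
  moreover have "compact (space (M \<Otimes>\<^sub>M N))"
    using assms by (simp add: space_pair_measure compact_finite_borel_def compact_Times)
  ultimately show ?thesis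
    using finite_measure_pair_measure[OF N.finite_measure_axioms M.finite_measure_axioms]
    by (simp add: compact_finite_borel_def)
qed

lemma integrable_continuous:
  fixes f :: "'a::{second_countable_topology, t2_space} \<Rightarrow> real"
  assumes M: "compact_finite_borel M" and f: "continuous_on UNIV f"
  shows "integrable M f"
proof -
  interpret finite_measure M using M by (simp add: compact_finite_borel_def)
  have "compact (f ` space M)"
    using M f by (auto simp: compact_finite_borel_def intro: compact_continuous_image continuous_on_subset)
  then obtain B where B: "\<And>x. x \<in> space M \<Longrightarrow> norm (f x) \<le> B"
    by (metis bounded_iff compact_imp_bounded imageI)
  \<comment> \<open>\<open>f\<close> is composed with the identity, which is measurable from
    \<open>M\<close> to the Borel sets.\<close>
  have "f \<in> borel_measurable M"
    using measurable_compose[of "\<lambda>x. x" M borel f borel] M f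
    by (simp add: compact_finite_borel_def borel_measurable_continuous_onI)
  then show ?thesis
    using B by (intro integrable_const_bound[of _ B] AE_I2)
qed

text \<open>Continuous functions are integrable over the product, so Fubini applies in either
  order.\<close>

lemma integral_pair_continuous:
  fixes f :: "_ \<Rightarrow> real"
  assumes M: "compact_finite_borel M" and N: "compact_finite_borel N" and f: "continuous_on UNIV f"
  shows "(LINT p|(M \<Otimes>\<^sub>M N). f p) = (LINT y|N. LINT x|M. f (x, y))"
    and "(LINT p|(M \<Otimes>\<^sub>M N). f p) = (LINT x|M. LINT y|N. f (x, y))"
proof -
  interpret M: finite_measure M using M by (simp add: compact_finite_borel_def)
  interpret N: finite_measure N using N by (simp add: compact_finite_borel_def)
  interpret pair_sigma_finite M N ..
  have "integrable (M \<Otimes>\<^sub>M N) (case_prod (\<lambda>x y. f (x, y)))"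
    using integrable_continuous[OF compact_finite_borel_pair[OF M N] f] by simp
  from integral_snd[OF this] integral_fst[OF this]
  show "(LINT p|(M \<Otimes>\<^sub>M N). f p) = (LINT y|N. LINT x|M. f (x, y))"
    and "(LINT p|(M \<Otimes>\<^sub>M N). f p) = (LINT x|M. LINT y|N. f (x, y))" by simp_all
qed

lemma integrable_surface:
  "continuous_on UNIV f \<Longrightarrow> integrable surface_measure (f :: 'a::euclidean_space \<Rightarrow> real)"
  by (rule integrable_continuous[OF compact_finite_borel_surface_measure])

section \<open>Symmetries of surface integrals\<close>

text \<open>An orthogonal map that carries \<open>y\<close> to \<open>y'\<close> and
  \<open>z\<close> to \<open>z'\<close> is a measure-preserving change of variables.\<close>

lemma surface_integral_pair_cong:
  fixes y z y' z' :: "'a::euclidean_space"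
  assumes "norm y = norm y'" "norm z = norm z'" "y \<bullet> z = y' \<bullet> z'"
  shows "(LINT x|surface_measure. poly p (x \<bullet> y) * poly q (x \<bullet> z))
       = (LINT x|surface_measure. poly p (x \<bullet> y') * poly q (x \<bullet> z'))"
proof -
  obtain T where T: "orthogonal_transformation T" "T y = y'" "T z = z'"
    by (rule ex_orthogonal_transformation_pair[OF assms])
  have i: "T x \<bullet> T v = x \<bullet> v" for x v
    using T(1) by (simp add: orthogonal_transformation_def)
  have "(LINT x|surface_measure. poly p (T x \<bullet> y') * poly q (T x \<bullet> z'))
      = (LINT x|surface_measure. poly p (x \<bullet> y') * poly q (x \<bullet> z'))"
    by (intro surface_integral_orthogonal[OF T(1)] borel_measurable_integrable integrable_surface
        continuous_intros)
  then show ?thesis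
    by (simp add: i flip: T(2,3))
qed

text \<open>The reflection along \<open>w\<close> fixes \<open>x \<bullet> e\<close> and negates
  \<open>x \<bullet> w\<close>, so the integral equals its own negative.\<close>

lemma surface_integral_odd:
  fixes w :: "'a::euclidean_space"
  assumes "e \<bullet> w = 0" "odd i"
  shows "(LINT x|surface_measure. poly p (x \<bullet> e) * (x \<bullet> w) ^ i) = 0"
proof -
  let ?R = "reflect w"
  have i: "?R x \<bullet> ?R v = x \<bullet> v" for x v
    using orthogonal_transformation_reflect[of w] by (simp add: orthogonal_transformation_def)
  have e: "?R x \<bullet> e = x \<bullet> e" for x
    using i[of x e] assms(1) by (simp add: reflect_orthogonal)
  have w: "?R x \<bullet> w = - (x \<bullet> w)" for x
    using i[of x w] by (simp add: reflect_self)
  have "(LINT x|surface_measure. poly p (?R x \<bullet> e) * (?R x \<bullet> w) ^ i)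
      = (LINT x|surface_measure. poly p (x \<bullet> e) * (x \<bullet> w) ^ i)"
    by (intro surface_integral_orthogonal orthogonal_transformation_reflect borel_measurable_integrable
        integrable_surface continuous_intros)
  then show ?thesis
    using assms(2) by (simp add: e w)
qed

section \<open>Zonal integrals\<close>

definition zonal_integral :: "'a::euclidean_space \<Rightarrow> real poly \<Rightarrow> real" where
  "zonal_integral e p = (LINT x|surface_measure. poly p (x \<bullet> e))"

lemma zonal_integral_cong:
  fixes e e' :: "'a::euclidean_space"
  shows "norm e = norm e' \<Longrightarrow> zonal_integral e p = zonal_integral e' p"
  using surface_integral_pair_cong[of e e' e e' p 1] by (simp add: zonal_integral_def dot_square_norm)

lemma zonal_integral_1:
  "zonal_integral (e :: 'a::euclidean_space) 1 = DIM('a) * unit_ball_vol DIM('a)"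
  using emeasure_surface_measure_space[where 'a='a]
  by (simp add: zonal_integral_def measure_def space_surface_measure)

section \<open>Moments of the zonal measure\<close>

lemma coeff_one_plus_square_power:
  "coeff ([:1, 0, 1 :: real:] ^ n) 0 = 1"
  "coeff ([:1, 0, 1 :: real:] ^ n) 1 = 0"
  "coeff ([:1, 0, 1 :: real:] ^ n) 2 = real n"
  by (induction n) (simp_all add: numeral_2_eq_2)

text \<open>With \<open>N = k + 2\<close>, compare the coefficients of \<open>s\<^sup>2\<close> in
  \<open>\<integral> (x \<bullet> (e + s w))\<^sup>N dx = (1 + s\<^sup>2)\<^bsup>N/2\<^esup> \<integral> (x \<bullet> e)\<^sup>N dx\<close>.\<close>
lemma surface_moment_mixed:
  fixes e w :: "'a::euclidean_space"
  assumes e: "norm e = 1" and w: "norm w = 1" and ew: "e \<bullet> w = 0" and k: "even k"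
  shows "real (k + 1) * (LINT x|surface_measure. (x \<bullet> w)\<^sup>2 * (x \<bullet> e) ^ k)
    = zonal_integral e (monom 1 (k + 2))"
proof -
  obtain j where j: "k + 2 = 2 * (j + 1)" using k by auto
  define N where "N = k + 2"
  define m where "m = zonal_integral e (monom 1 N)"
  define M where "M i = (LINT x|surface_measure. (x \<bullet> w) ^ i * (x \<bullet> e) ^ (N - i))" for i
  \<comment> \<open>By the binomial theorem, \<open>P\<close> is the integral of
    \<open>(x \<bullet> (e + s *\<^sub>R w)) ^ N\<close> as a polynomial in
    \<open>s\<close>.\<close>
  define P where "P = (\<Sum>i\<le>N. monom (real (N choose i) * M i) i)"
  have "poly P s = poly (smult m ([:1, 0, 1:] ^ (j + 1))) s" for s
  proof -
    define r where "r = sqrt (1 + s\<^sup>2)"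
    have r0: "r > 0" by (simp add: r_def add_pos_nonneg)
    define u where "u = (e + s *\<^sub>R w) /\<^sub>R r"
    have "(norm (e + s *\<^sub>R w))\<^sup>2 = 1 + s\<^sup>2"
      using e w ew unfolding power2_norm_eq_inner
      by (simp add: inner_simps inner_commute[of w e] norm_eq_1 power2_eq_square)
    then have "norm (e + s *\<^sub>R w) = r"
      unfolding r_def by (metis norm_ge_zero real_sqrt_unique)
    then have u: "norm u = norm e" using r0 e by (simp add: u_def)
    have ru: "e + s *\<^sub>R w = r *\<^sub>R u" using r0 by (simp add: u_def)
    \<comment> \<open>The exponent \<open>N\<close> is even, so the square root in \<open>r\<close>
      disappears and both sides are polynomials in \<open>s\<close>.\<close>
    have rN: "r ^ N = (1 + s\<^sup>2) ^ (j + 1)"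
      unfolding N_def j power_mult by (simp add: r_def add_nonneg_nonneg)
    have "poly P s = (\<Sum>i\<le>N. LINT x|surface_measure. (real (N choose i) * s ^ i) * ((x \<bullet> w) ^ i * (x \<bullet> e) ^ (N - i)))"
      by (simp add: P_def poly_sum poly_monom M_def mult_ac)
    also have "\<dots> = (LINT x|surface_measure. (\<Sum>i\<le>N. (real (N choose i) * s ^ i) * ((x \<bullet> w) ^ i * (x \<bullet> e) ^ (N - i))))"
      by (rule Bochner_Integration.integral_sum[symmetric]) (intro integrable_surface continuous_intros)
    also have "\<dots> = (LINT x|surface_measure. (x \<bullet> (e + s *\<^sub>R w)) ^ N)"
    proof (rule arg_cong[where f="integral\<^sup>L surface_measure"], rule ext)
      fix x
      have "(x \<bullet> (e + s *\<^sub>R w)) ^ N = (s * (x \<bullet> w) + x \<bullet> e) ^ N"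
        by (simp add: inner_simps add.commute)
      also have "\<dots> = (\<Sum>i\<le>N. (real (N choose i) * s ^ i) * ((x \<bullet> w) ^ i * (x \<bullet> e) ^ (N - i)))"
        by (simp add: binomial_ring power_mult_distrib mult_ac)
      finally show "(\<Sum>i\<le>N. (real (N choose i) * s ^ i) * ((x \<bullet> w) ^ i * (x \<bullet> e) ^ (N - i)))
        = (x \<bullet> (e + s *\<^sub>R w)) ^ N" by simp
    qed
    also have "\<dots> = (LINT x|surface_measure. r ^ N * (x \<bullet> u) ^ N)"
      by (simp add: ru power_mult_distrib)
    also have "\<dots> = r ^ N * zonal_integral u (monom 1 N)"
      by (simp add: zonal_integral_def poly_monom)
    also have "\<dots> = (1 + s\<^sup>2) ^ (j + 1) * m"
      by (simp add: rN m_def zonal_integral_cong[OF u])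
    finally show ?thesis by (simp add: power2_eq_square algebra_simps)
  qed
  then have "P = smult m ([:1, 0, 1:] ^ (j + 1))" by (simp add: poly_eq_poly_eq_iff[symmetric] fun_eq_iff)
  then have "coeff P 2 = m * real (j + 1)"
    by (simp only: coeff_smult coeff_one_plus_square_power)
  moreover have "coeff P 2 = real (N choose 2) * M 2"
  proof -
    have "2 \<le> N" by (simp add: N_def)
    then show ?thesis by (simp add: P_def coeff_sum coeff_monom)
  qed
  \<comment> \<open>Since \<open>N = 2 * (j + 1)\<close> and \<open>N - 1 = k + 1\<close>, the
    factor \<open>j + 1\<close> appears on both sides and cancels.\<close>
  moreover have "real (N choose 2) = real (j + 1) * real (k + 1)"
  proof -
    have "N choose 2 = (j + 1) * (k + 1)"
      unfolding choose_two N_def using j by (simp add: mult.assoc)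
    then show ?thesis by (simp only: of_nat_mult)
  qed
  ultimately have "real (j + 1) * (real (k + 1) * M 2) = real (j + 1) * m" by (simp add: mult_ac)
  then have "real (k + 1) * M 2 = m" by (metis mult_left_cancel of_nat_0_eq_iff add_is_0 zero_neq_one)
  then show ?thesis by (simp add: M_def m_def N_def)
qed

text \<open>The squared coordinates of a point of the sphere sum to 1. Inserting this sum into
  \<open>k + 1\<close> times the \<open>k\<close>-th moment gives \<open>k + 1\<close> copies of the
  next moment from the direction \<open>b\<close> and, by \<open>surface_moment_mixed\<close>, one
  from each other basis direction. For odd \<open>k\<close> both moments vanish.\<close>

lemma zonal_integral_moment:
  fixes e :: "'a::euclidean_space"
  assumes "norm e = 1"
  shows "real (k + DIM('a)) * zonal_integral e (monom 1 (k + 2)) = real (k + 1) * zonal_integral e (monom 1 k)"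
proof -
  obtain b :: 'a where b: "b \<in> Basis" using nonempty_Basis by blast
  have eb: "zonal_integral e p = zonal_integral b p" for p
    using assms b by (intro zonal_integral_cong) simp
  show ?thesis
  proof (cases "even k")
    case False
    \<comment> \<open>With \<open>e = 0\<close> and \<open>p = 1\<close> the orthogonality is
      trivial and only the odd power remains.\<close>
    have "zonal_integral b (monom 1 i) = 0" if "odd i" for i
      using surface_integral_odd[of 0 b i 1] that by (simp add: zonal_integral_def poly_monom)
    with False show ?thesis by (simp add: eb)
  next
    case True
    let ?m = "zonal_integral b (monom 1 (k + 2))"
    have "zonal_integral b (monom 1 k) = (LINT x|surface_measure. (\<Sum>c\<in>Basis. (x \<bullet> c)\<^sup>2 * (x \<bullet> b) ^ k))"
      unfolding zonal_integral_def
    proof (rule Bochner_Integration.integral_cong[OF refl])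
      fix x :: 'a assume "x \<in> space surface_measure"
      then have "x \<bullet> x = 1" by (simp add: space_surface_measure norm_eq_1)
      then have "(\<Sum>c\<in>Basis. (x \<bullet> c)\<^sup>2) = 1"
        using euclidean_inner[of x x] by (simp add: power2_eq_square)
      then show "poly (monom 1 k) (x \<bullet> b) = (\<Sum>c\<in>Basis. (x \<bullet> c)\<^sup>2 * (x \<bullet> b) ^ k)"
        by (simp add: poly_monom flip: sum_distrib_right)
    qed
    also have "\<dots> = (\<Sum>c\<in>Basis. LINT x|surface_measure. (x \<bullet> c)\<^sup>2 * (x \<bullet> b) ^ k)"
      by (intro Bochner_Integration.integral_sum integrable_surface continuous_intros)
    also have "real (k + 1) * \<dots> = (\<Sum>c\<in>Basis. real (k + 1) * (LINT x|surface_measure. (x \<bullet> c)\<^sup>2 * (x \<bullet> b) ^ k))"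
      by (rule sum_distrib_left)
    also have "\<dots> = (\<Sum>c\<in>Basis. if c = b then real (k + 1) * ?m else ?m)"
    proof (rule sum.cong[OF refl])
      fix c :: 'a assume c: "c \<in> Basis"
      show "real (k + 1) * (LINT x|surface_measure. (x \<bullet> c)\<^sup>2 * (x \<bullet> b) ^ k) = (if c = b then real (k + 1) * ?m else ?m)"
      proof (cases "c = b")
        case True
        then show ?thesis by (simp add: zonal_integral_def poly_monom power2_eq_square mult.assoc)
      next
        case False
        then show ?thesis
          using surface_moment_mixed[of b c k] b c \<open>even k\<close> by (simp add: inner_Basis)
      qed
    qed
    also have "\<dots> = real (k + DIM('a)) * ?m"
    proof -
      have "real DIM('a) = real (DIM('a) - 1) + 1" using DIM_positive[where 'a='a] by linarith
      moreover have "(\<Sum>c\<in>Basis. if c = b then real (k + 1) * ?m else ?m) = real (k + 1) * ?m + real (DIM('a) - 1) * ?m"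
        using b by (subst sum.remove[of _ b]) (auto simp: card_Diff_singleton intro!: sum.neutral)
      ultimately show ?thesis by (simp add: algebra_simps)
    qed
    finally show ?thesis by (simp only: eb)
  qed
qed

text \<open>The integrand is the derivative of \<open>r(t) (1 - t\<^sup>2)\<^bsup>d/2\<^esup>\<close>, which vanishes at both ends.\<close>
lemma weighted_inner_derivative:
  assumes d: "2 \<le> d"
  shows "weighted_inner d 1 (pderiv r * [:1, 0, -1:] - smult (real d) (monom 1 1 * r)) = 0"
proof -
  let ?q = "pderiv r * [:1, 0, -1:] - smult (real d) (monom 1 1 * r)"
  let ?w = "\<lambda>t::real. (1 - t\<^sup>2) powr (real d / 2 - 1)"
  let ?F = "\<lambda>t::real. poly r t * (1 - t\<^sup>2) powr (real d / 2)"
  have sq: "t\<^sup>2 \<le> 1" if "t \<in> {-1..1}" for t :: real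
    using that by (simp add: abs_square_le_1 abs_le_iff)
  have "((\<lambda>t. poly ?q t * ?w t) has_integral (?F 1 - ?F (-1))) {-1..1}"
  \<comment> \<open>The base \<open>1 - t^2\<close> vanishes at both ends, and \<open>powr\<close>
    is differentiated only at a positive base, so the derivative is taken in the open
    interval.\<close>
  proof (rule fundamental_theorem_of_calculus_interior)
    show "continuous_on {-1..1} ?F"
      using d sq by (intro continuous_intros continuous_on_powr') auto
    fix t :: real assume t: "t \<in> {-1<..<1}"
    then have t1: "t\<^sup>2 < 1" by (simp add: abs_square_less_1 abs_less_iff)
    have w: "(1 - t\<^sup>2) powr (real d / 2) = (1 - t\<^sup>2) * ?w t"
      using t1 powr_mult_base[of "1 - t\<^sup>2" "real d / 2 - 1"] by simp
    have "(?F has_real_derivative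
        poly (pderiv r) t * (1 - t\<^sup>2) powr (real d / 2) +
        (real d / 2 * (1 - t\<^sup>2) powr (real d / 2 - 1) * (- (2 * t))) * poly r t) (at t)"
    proof (rule DERIV_mult[OF poly_DERIV])
      show "((\<lambda>t. (1 - t\<^sup>2) powr (real d / 2)) has_real_derivative
        real d / 2 * (1 - t\<^sup>2) powr (real d / 2 - 1) * (- (2 * t))) (at t)"
        using t1 by (auto intro!: derivative_eq_intros has_real_derivative_powr')
    qed
    moreover have "poly (pderiv r) t * (1 - t\<^sup>2) powr (real d / 2) +
        (real d / 2 * (1 - t\<^sup>2) powr (real d / 2 - 1) * (- (2 * t))) * poly r t = poly ?q t * ?w t"
      unfolding w by (simp add: poly_monom algebra_simps power2_eq_square)
    ultimately show "(?F has_vector_derivative poly ?q t * ?w t) (at t)"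
      by (simp add: has_real_derivative_iff_has_vector_derivative)
  qed simp
  then have "integral {-1..1} (\<lambda>t. poly ?q t * ?w t) = 0"
    using d by (simp add: integral_unique)
  then show ?thesis
    using set_borel_integral_eq_integral(2)[OF set_integrable_poly_weight[OF d, of ?q]]
    by (simp add: weighted_inner_def)
qed

section \<open>Comparison of the zonal measure with the Gegenbauer weight\<close>

text \<open>These are the cases \<open>r = 1\<close> and \<open>r = monom 1 (k + 1)\<close> of
  \<open>weighted_inner_derivative\<close>.\<close>

lemma weighted_inner_moment:
  assumes d: "2 \<le> d"
  shows "weighted_inner d 1 (monom 1 1) = 0"
    and "real (k + d + 1) * weighted_inner d 1 (monom 1 (k + 2)) = real (k + 1) * weighted_inner d 1 (monom 1 k)"
proof -
  have "weighted_inner d 1 (smult (- real d) (monom 1 1)) = 0"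
    using weighted_inner_derivative[OF d, of 1] by (simp only: pderiv_1 mult_zero_left diff_0 mult_1_right smult_minus_left)
  then show "weighted_inner d 1 (monom 1 1) = 0"
    unfolding weighted_inner_smult using d by simp
  have "pderiv (monom 1 (k + 1)) * [:1, 0, -1:] - smult (real d) (monom 1 1 * monom 1 (k + 1))
      = smult (real (k + 1)) (monom 1 k) - smult (real (k + d + 1)) (monom 1 (k + 2))"
    by (rule poly_ext) (simp add: pderiv_monom poly_monom algebra_simps power2_eq_square)
  then show "real (k + d + 1) * weighted_inner d 1 (monom 1 (k + 2)) = real (k + 1) * weighted_inner d 1 (monom 1 k)"
    using weighted_inner_derivative[OF d, of "monom 1 (k + 1)"]
    by (simp only: weighted_inner_diff[OF d] weighted_inner_smult)
qed

text \<open>Both functionals kill the first moment, and for \<open>DIM('a) = d + 1\<close> they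
  satisfy the same two-term recurrence, so their moments are proportional; linearity extends this to
  all polynomials. Multiplying crosswise by the total masses avoids division.\<close>

lemma zonal_integral_eq_weighted:
  fixes e :: "'a::euclidean_space"
  assumes d: "2 \<le> d" and D: "DIM('a) = d + 1" and e: "norm e = 1"
  shows "zonal_integral e p * weighted_inner d 1 1 = zonal_integral e 1 * weighted_inner d 1 p"
proof -
  let ?W = "weighted_inner d 1"
  have mon: "zonal_integral e (monom 1 k) * ?W 1 = zonal_integral e 1 * ?W (monom 1 k)" for k
  proof (induction k rule: less_induct)
    case (less k)
    consider "k = 0" | "k = 1" | i where "k = i + 2"
      by (metis One_nat_def add_2_eq_Suc' not0_implies_Suc)
    then show ?case
    proof cases
      case 1
      then show ?thesis by (simp add: monom_0 flip: one_pCons)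
    next
      case 2
      have "zonal_integral e (monom 1 1) = 0"
        using surface_integral_odd[of 0 e 1 1] by (simp add: zonal_integral_def poly_monom)
      then show ?thesis using 2 weighted_inner_moment(1)[OF d] by simp
    next
      case 3
      have Z: "real (i + d + 1) * zonal_integral e (monom 1 k) = real (i + 1) * zonal_integral e (monom 1 i)"
        using zonal_integral_moment[OF e, of i] D 3 by (simp add: add.assoc)
      have W: "real (i + d + 1) * ?W (monom 1 k) = real (i + 1) * ?W (monom 1 i)"
        using weighted_inner_moment(2)[OF d, of i] 3 by simp
      have "real (i + d + 1) * (zonal_integral e (monom 1 k) * ?W 1)
          = real (i + 1) * (zonal_integral e (monom 1 i) * ?W 1)"
        using Z by (metis mult.assoc)
      also have "\<dots> = real (i + 1) * (zonal_integral e 1 * ?W (monom 1 i))"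
        using less.IH[of i] 3 by simp
      also have "\<dots> = real (i + d + 1) * (zonal_integral e 1 * ?W (monom 1 k))"
        using W by (metis mult.left_commute)
      finally show ?thesis
        by (metis mult_left_cancel of_nat_0_eq_iff add_is_0 zero_neq_one)
    qed
  qed
  have "zonal_integral e p = (\<Sum>i\<le>degree p. coeff p i * zonal_integral e (monom 1 i))"
  proof -
    have "zonal_integral e p = (LINT x|surface_measure. (\<Sum>i\<le>degree p. coeff p i * (x \<bullet> e) ^ i))"
      by (simp add: zonal_integral_def poly_altdef)
    also have "\<dots> = (\<Sum>i\<le>degree p. LINT x|surface_measure. coeff p i * (x \<bullet> e) ^ i)"
      by (intro Bochner_Integration.integral_sum integrable_surface continuous_intros)
    finally show ?thesis by (simp add: zonal_integral_def poly_monom)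
  qed
  moreover have "?W p = (\<Sum>i\<le>degree p. coeff p i * ?W (monom 1 i))"
  proof -
    have "p = (\<Sum>i\<le>degree p. smult (coeff p i) (monom 1 i))"
      by (simp add: smult_monom poly_as_sum_of_monoms)
    then have "?W p = ?W (\<Sum>i\<le>degree p. smult (coeff p i) (monom 1 i))" by simp
    then show ?thesis by (simp add: weighted_inner_sum[OF d] weighted_inner_smult)
  qed
  ultimately show ?thesis
    using mon by (simp add: sum_distrib_left sum_distrib_right mult.assoc mult.left_commute)
qed

section \<open>The Funk--Hecke formula\<close>

text \<open>By invariance, \<open>y\<close> and \<open>z\<close> may be replaced by \<open>e\<close>
  and \<open>s e + sqrt (1 - s^2) w\<close> with \<open>e\<close>, \<open>w\<close> orthonormal and
  \<open>s = y \<bullet> z\<close>. Odd powers of the root meet integrals that vanish by reflection,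
  so a polynomial in \<open>s\<close> remains, and expanding a \<open>k\<close>-th power yields
  degree at most \<open>k\<close>.\<close>

lemma ex_poly_surface_convolution:
  fixes p q :: "real poly"
  assumes D: "2 \<le> DIM('a::euclidean_space)"
  shows "\<exists>Q. degree Q \<le> degree q \<and> (\<forall>y z :: 'a. norm y = 1 \<longrightarrow> norm z = 1 \<longrightarrow>
    (LINT x|surface_measure. poly p (x \<bullet> y) * poly q (x \<bullet> z)) = poly Q (y \<bullet> z))"
proof -
  obtain e w :: 'a where ew: "e \<in> Basis" "w \<in> Basis" "e \<noteq> w"
    using D card_le_Suc0_iff_eq[OF finite_Basis[where 'a='a]] by fastforce
  then have e: "norm e = 1" and w: "norm w = 1" and ew0: "e \<bullet> w = 0"
    by (simp_all add: inner_Basis)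
  define M where "M i j = (LINT x|surface_measure. poly (p * monom 1 j) (x \<bullet> e) * (x \<bullet> w) ^ i)" for i j
  \<comment> \<open>This is the expansion of \<open>q\<close> at
    \<open>r (x \<bullet> w) + s (x \<bullet> e)\<close> with \<open>r^i\<close> replaced by
    \<open>(1 - s^2)^(i div 2)\<close>. For odd \<open>i\<close> the rounding is harmless because
    \<open>M i (k - i)\<close> is zero.\<close>
  define Q where "Q = (\<Sum>k\<le>degree q. \<Sum>i\<le>k. smult (coeff q k * (real (k choose i) * M i (k - i)))
    ([:1, 0, -1:] ^ (i div 2) * monom 1 (k - i)))"
  have deg: "degree Q \<le> degree q"
    unfolding Q_def
  proof (intro degree_sum_le finite_atMost order.trans[OF degree_smult_le])
    fix k i assume k: "k \<in> {..degree q}" and i: "i \<in> {..k}"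
    have "degree ([:1, 0, -1 :: real:] ^ (i div 2)) \<le> 2 * (i div 2)"
      using degree_power_le[of "[:1, 0, -1 :: real:]" "i div 2"] by simp
    moreover have "degree (monom (1::real) (k - i)) \<le> k - i"
      by (rule degree_monom_le)
    ultimately have "degree ([:1, 0, -1 :: real:] ^ (i div 2) * monom 1 (k - i)) \<le> 2 * (i div 2) + (k - i)"
      by (intro order.trans[OF degree_mult_le] add_mono)
    also have "\<dots> \<le> degree q" using k i by simp
    finally show "degree ([:1, 0, -1 :: real:] ^ (i div 2) * monom 1 (k - i)) \<le> degree q" .
  qed
  have "(LINT x|surface_measure. poly p (x \<bullet> y) * poly q (x \<bullet> z)) = poly Q (y \<bullet> z)"
    if y: "norm y = 1" and z: "norm z = 1" for y z :: 'a
  proof -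
    define s where "s = y \<bullet> z"
    have "\<bar>s\<bar> \<le> 1" using Cauchy_Schwarz_ineq2[of y z] y z by (simp add: s_def)
    then have s1: "s\<^sup>2 \<le> 1" by (simp add: abs_square_le_1)
    define r where "r = sqrt (1 - s\<^sup>2)"
    have r2: "r\<^sup>2 = 1 - s\<^sup>2" using s1 by (simp add: r_def)
    \<comment> \<open>A unit vector with \<open>e \<bullet> u = s\<close>, so that \<open>e\<close>
      and \<open>u\<close> can stand for \<open>y\<close> and \<open>z\<close>.\<close>
    define u where "u = s *\<^sub>R e + r *\<^sub>R w"
    have "u \<bullet> u = s\<^sup>2 + r\<^sup>2"
      using e w ew0 by (simp add: u_def inner_simps inner_commute[of w e] norm_eq_1 power2_eq_square)
    then have u: "norm u = 1" by (simp add: r2 norm_eq_1)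
    have eu: "e \<bullet> u = s" using e ew0 by (simp add: u_def inner_simps norm_eq_1)
    have summand: "(LINT x|surface_measure. poly p (x \<bullet> e) * (r * (x \<bullet> w)) ^ i * (s * (x \<bullet> e)) ^ j)
       = M i j * poly ([:1, 0, -1:] ^ (i div 2) * monom 1 j) s" for i j
    proof -
      have "(LINT x|surface_measure. poly p (x \<bullet> e) * (r * (x \<bullet> w)) ^ i * (s * (x \<bullet> e)) ^ j)
         = (LINT x|surface_measure. (r ^ i * s ^ j) * (poly (p * monom 1 j) (x \<bullet> e) * (x \<bullet> w) ^ i))"
        by (simp add: poly_monom power_mult_distrib mult_ac)
      also have "\<dots> = (r ^ i * s ^ j) * M i j"
        unfolding M_def by (rule integral_mult_right_zero)
      also have "\<dots> = M i j * poly ([:1, 0, -1:] ^ (i div 2) * monom 1 j) s"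
      proof (cases "even i")
        case True
        then have "r ^ i = (r\<^sup>2) ^ (i div 2)" by (simp flip: power_mult)
        then have "r ^ i = (1 - s * s) ^ (i div 2)" by (simp add: r2 flip: power2_eq_square)
        then show ?thesis by (simp add: poly_monom mult_ac)
      next
        case False
        then have "M i j = 0" unfolding M_def by (rule surface_integral_odd[OF ew0])
        then show ?thesis by simp
      qed
      finally show ?thesis .
    qed
    have "(LINT x|surface_measure. poly p (x \<bullet> y) * poly q (x \<bullet> z))
        = (LINT x|surface_measure. poly p (x \<bullet> e) * poly q (x \<bullet> u))"
      by (rule surface_integral_pair_cong) (simp_all add: y z e u eu s_def)
    also have "\<dots> = (LINT x|surface_measure. (\<Sum>k\<le>degree q. \<Sum>i\<le>k. (coeff q k * real (k choose i)) *
        (poly p (x \<bullet> e) * (r * (x \<bullet> w)) ^ i * (s * (x \<bullet> e)) ^ (k - i))))"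
    proof (rule arg_cong[where f="integral\<^sup>L surface_measure"], rule ext)
      fix x
      have "x \<bullet> u = r * (x \<bullet> w) + s * (x \<bullet> e)" by (simp add: u_def inner_simps)
      then have "poly q (x \<bullet> u) = (\<Sum>k\<le>degree q. coeff q k *
          (\<Sum>i\<le>k. real (k choose i) * (r * (x \<bullet> w)) ^ i * (s * (x \<bullet> e)) ^ (k - i)))"
        by (simp add: poly_altdef binomial_ring)
      then show "poly p (x \<bullet> e) * poly q (x \<bullet> u) = (\<Sum>k\<le>degree q. \<Sum>i\<le>k. (coeff q k * real (k choose i)) *
        (poly p (x \<bullet> e) * (r * (x \<bullet> w)) ^ i * (s * (x \<bullet> e)) ^ (k - i)))"
        by (simp only: sum_distrib_left mult_ac)
    qed
    also have "\<dots> = (\<Sum>k\<le>degree q. \<Sum>i\<le>k. LINT x|surface_measure. (coeff q k * real (k choose i)) *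
        (poly p (x \<bullet> e) * (r * (x \<bullet> w)) ^ i * (s * (x \<bullet> e)) ^ (k - i)))"
      by (subst Bochner_Integration.integral_sum, (intro integrable_surface continuous_intros)[1],
          intro sum.cong[OF refl] Bochner_Integration.integral_sum integrable_surface continuous_intros)
    also have "\<dots> = (\<Sum>k\<le>degree q. \<Sum>i\<le>k. (coeff q k * real (k choose i)) *
        (M i (k - i) * poly ([:1, 0, -1:] ^ (i div 2) * monom 1 (k - i)) s))"
      by (simp only: integral_mult_right_zero summand)
    also have "\<dots> = poly Q s"
      by (simp add: Q_def poly_sum mult_ac)
    finally show ?thesis by (simp add: s_def)
  qed
  with deg show ?thesis by blast
qed

section \<open>Recognising a Gegenbauer polynomial by orthogonality\<close>

lemma gegenbauer_family_nonzero:
  assumes "gegenbauer_family d G"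
  shows "G l \<noteq> 0"
proof
  assume "G l = 0"
  then have "poly (G l) 1 = 0" by simp
  then show False using assms by (simp add: gegenbauer_family_iff)
qed

text \<open>Subtracting the multiple of \<open>G l\<close> with the same coefficient in degree
  \<open>l\<close> leaves \<open>r\<close> of lower degree. It is orthogonal to \<open>Q\<close> and
  to \<open>G l\<close>, hence to itself, so it is zero by positivity. Evaluation at 1 identifies
  the multiple.\<close>

lemma orthogonal_lower_imp_smult:
  assumes d: "2 \<le> d" and G: "gegenbauer_family d G"
    and deg: "degree Q \<le> l" and orth: "\<And>q. degree q < l \<Longrightarrow> weighted_inner d Q q = 0"
  shows "Q = smult (poly Q 1) (G l)"
proof -
  have Gl: "degree (G l) = l" "poly (G l) 1 = 1" and nz: "\<And>k. G k \<noteq> 0"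
    using G gegenbauer_family_nonzero[OF G] by (simp_all add: gegenbauer_family_iff)
  define c where "c = coeff Q l / lead_coeff (G l)"
  define r where "r = Q - smult c (G l)"
  have "coeff r l = 0" using nz[of l] Gl(1) leading_coeff_neq_0[of "G l"] by (simp add: r_def c_def)
  moreover have "degree r \<le> l"
    using Gl deg by (auto simp: r_def intro!: degree_diff_le order.trans[OF degree_smult_le])
  ultimately have r: "r = 0 \<or> degree r < l"
    by (metis leading_coeff_0_iff le_neq_implies_less)
  have Gr: "weighted_inner d (G l) r = 0"
  proof (rule weighted_inner_orthogonal_lower[OF d _ _ r])
    show "degree (G k) = k \<and> G k \<noteq> 0" if "k < l" for k
      using G nz by (simp add: gegenbauer_family_iff)
    show "weighted_inner d (G l) (G k) = 0" if "k < l" for k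
      using G that unfolding gegenbauer_family_iff by auto
  qed
  have "r = 0"
  proof (rule ccontr)
    assume "r \<noteq> 0"
    with r have "weighted_inner d r Q = 0" using orth weighted_inner_commute by metis
    moreover have "weighted_inner d r r = weighted_inner d r Q - c * weighted_inner d r (G l)"
      by (subst (2) r_def) (simp add: weighted_inner_diff[OF d] weighted_inner_smult)
    ultimately have "weighted_inner d r r = 0" using Gr by (simp add: weighted_inner_commute[of d r "G l"])
    then show False using weighted_inner_pos[OF d, of r r] \<open>r \<noteq> 0\<close> by simp
  qed
  then have Q: "Q = smult c (G l)" by (simp add: r_def)
  moreover from this have "poly Q 1 = c" using Gl by simp
  ultimately show ?thesis by metis
qed

text \<open>The left-hand side is \<open>Q(y \<bullet> z)\<close> with
  \<open>degree Q \<le> l\<close>, and by Fubini convolution with \<open>p\<close> is symmetric and does not raise degrees, so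
  \<open>Q\<close> inherits from the Gegenbauer polynomial the orthogonality to all lower degrees.\<close>
lemma funk_hecke:
  fixes y z :: "'a::euclidean_space"
  assumes d: "2 \<le> d" and D: "DIM('a) = d + 1" and y: "norm y = 1" and z: "norm z = 1"
  shows "(LINT x|surface_measure. poly p (x \<bullet> y) * poly (gegenbauer d l) (x \<bullet> z))
    = zonal_integral y (p * gegenbauer d l) * poly (gegenbauer d l) (y \<bullet> z)"
proof -
  let ?G = "gegenbauer d l"
  have fam: "gegenbauer_family d (gegenbauer d)" by (rule gegenbauer_family_gegenbauer[OF d])
  have D2: "2 \<le> DIM('a)" using d D by simp
  have degG: "degree ?G = l" using fam by (simp add: gegenbauer_family_iff)
  obtain Q where Q: "degree Q \<le> l"
    "\<And>y z :: 'a. norm y = 1 \<Longrightarrow> norm z = 1 \<Longrightarrow>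
      (LINT x|surface_measure. poly p (x \<bullet> y) * poly ?G (x \<bullet> z)) = poly Q (y \<bullet> z)"
    using ex_poly_surface_convolution[OF D2, of ?G p] degG by auto
  have W1: "weighted_inner d 1 1 > 0" by (rule weighted_inner_pos[OF d]) simp_all
  have Z1: "zonal_integral z 1 > 0" using unit_ball_vol_pos[of "real DIM('a)"] by (simp add: zonal_integral_1)
  \<comment> \<open>Both total masses are positive, so orthogonality can be moved between the sphere
    and the interval.\<close>
  have zero: "zonal_integral z r = 0 \<longleftrightarrow> weighted_inner d 1 r = 0" for r
    using zonal_integral_eq_weighted[OF d D z, of r] W1 Z1 by auto
  have "weighted_inner d Q q = 0" if q: "degree q < l" for q
  proof -
    obtain P where P: "degree P \<le> degree q"
      "\<And>y z :: 'a. norm y = 1 \<Longrightarrow> norm z = 1 \<Longrightarrow>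
        (LINT x|surface_measure. poly p (x \<bullet> y) * poly q (x \<bullet> z)) = poly P (y \<bullet> z)"
      using ex_poly_surface_convolution[OF D2, of q p] by blast
    \<comment> \<open>Integrating over \<open>x\<close> first produces \<open>Q * q\<close>,
      integrating over \<open>v\<close> first produces \<open>?G * P\<close>, each evaluated at the
      inner product with \<open>z\<close>.\<close>
    let ?f = "\<lambda>(v, x). poly p (x \<bullet> v) * poly ?G (x \<bullet> z) * poly q (v \<bullet> z)"
    note cfb = compact_finite_borel_surface_measure
    have f: "continuous_on UNIV ?f"
      unfolding case_prod_beta by (intro continuous_intros)
    have "zonal_integral z (Q * q) = (LINT v|surface_measure. LINT x|surface_measure. ?f (v, x))"
      unfolding zonal_integral_def
    proof (rule Bochner_Integration.integral_cong[OF refl])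
      fix v :: 'a assume "v \<in> space surface_measure"
      then have "poly Q (v \<bullet> z) = (LINT x|surface_measure. poly p (x \<bullet> v) * poly ?G (x \<bullet> z))"
        using Q(2)[of v z] z by (simp add: space_surface_measure)
      then show "poly (Q * q) (v \<bullet> z) = (LINT x|surface_measure. ?f (v, x))"
        by simp
    qed
    also have "\<dots> = (LINT x|surface_measure. LINT v|surface_measure. ?f (v, x))"
      using integral_pair_continuous[OF cfb cfb f] by simp
    also have "\<dots> = zonal_integral z (?G * P)"
      unfolding zonal_integral_def
    proof (rule Bochner_Integration.integral_cong[OF refl])
      fix x :: 'a assume "x \<in> space surface_measure"
      then have "poly P (x \<bullet> z) = (LINT v|surface_measure. poly p (v \<bullet> x) * poly q (v \<bullet> z))"
        using P(2)[of x z] z by (simp add: space_surface_measure)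
      moreover have "(LINT v|surface_measure. ?f (v, x))
          = (LINT v|surface_measure. poly ?G (x \<bullet> z) * (poly p (v \<bullet> x) * poly q (v \<bullet> z)))"
        unfolding case_prod_conv by (subst inner_commute[of x]) (simp only: mult_ac)
      ultimately show "(LINT v|surface_measure. ?f (v, x)) = poly (?G * P) (x \<bullet> z)"
        by simp
    qed
    also have "\<dots> = 0"
    proof -
      \<comment> \<open>Convolution with \<open>p\<close> has kept the degree of \<open>P\<close>
        below \<open>l\<close>.\<close>
      have "weighted_inner d ?G P = 0"
      proof (rule weighted_inner_orthogonal_lower[OF d, of l "gegenbauer d"])
        show "degree (gegenbauer d k) = k \<and> gegenbauer d k \<noteq> 0" for k
          using fam gegenbauer_family_nonzero[OF fam] unfolding gegenbauer_family_iff by blast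
        show "weighted_inner d ?G (gegenbauer d k) = 0" if "k < l" for k
          using fam that unfolding gegenbauer_family_iff by (metis less_irrefl)
        show "P = 0 \<or> degree P < l" using P(1) q by simp
      qed
      then show ?thesis
        using weighted_inner_mult[of d 1 ?G P] by (simp add: zero)
    qed
    finally show ?thesis
      using weighted_inner_mult[of d 1 Q q] by (simp add: zero)
  qed
  then have "poly Q (y \<bullet> z) = poly (smult (poly Q 1) ?G) (y \<bullet> z)"
    by (intro arg_cong[where f="\<lambda>r. poly r (y \<bullet> z)"] orthogonal_lower_imp_smult[OF d fam Q(1)])
  \<comment> \<open>The eigenvalue is read off at \<open>z = y\<close>, where the inner product is
    1.\<close>
  moreover have "poly Q 1 = zonal_integral y (p * ?G)"
    using Q(2)[OF y y] y by (simp add: zonal_integral_def norm_eq_1)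
  ultimately show ?thesis
    using Q(2)[OF y z] by simp
qed

text \<open>By rotation invariance the inner integral is independent of \<open>y\<close>, so the
  outer one contributes only the total mass \<open>zonal_integral e 1\<close>.\<close>

lemma zonal_integral_pair:
  fixes e :: "'a::euclidean_space"
  assumes e: "norm e = 1"
  shows "(LINT (x, y)|(surface_measure \<Otimes>\<^sub>M surface_measure). poly p ((x :: 'a) \<bullet> y))
    = zonal_integral e 1 * zonal_integral e p"
proof -
  note cfb = compact_finite_borel_surface_measure
  have f: "continuous_on UNIV (\<lambda>(x::'a, y). poly p (x \<bullet> y))"
    unfolding case_prod_beta by (intro continuous_intros)
  have "(LINT (x, y)|(surface_measure \<Otimes>\<^sub>M surface_measure). poly p ((x :: 'a) \<bullet> y))
      = (LINT y|surface_measure. zonal_integral (y :: 'a) p)"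
    using integral_pair_continuous(1)[OF cfb cfb f] by (simp add: zonal_integral_def)
  also have "\<dots> = (LINT y|(surface_measure :: 'a measure). zonal_integral e p)"
    using e by (intro Bochner_Integration.integral_cong zonal_integral_cong refl)
      (simp add: space_surface_measure)
  finally show ?thesis by (simp add: zonal_integral_def)
qed

section \<open>Integrating out a vertex\<close>

text \<open>Funk-Hecke for \<open>p = gegenbauer d l ^ q\<close>. The reference vector
  \<open>e\<close> makes the factor visibly independent of \<open>y\<close>, and \<open>c\<close>
  collects the factors free of the integrated vertex.\<close>

lemma gegenbauer_convolution:
  fixes e y z :: "'a::euclidean_space"
  assumes d: "2 \<le> d" "DIM('a) = d + 1" and e: "norm e = 1" and y: "norm y = 1" and z: "norm z = 1"
  shows "(LINT x|surface_measure. poly (gegenbauer d l) (x \<bullet> y) ^ q * poly (gegenbauer d l) (x \<bullet> z) * c)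
    = zonal_integral e (gegenbauer d l ^ (q + 1)) * poly (gegenbauer d l) (y \<bullet> z) * c"
  using funk_hecke[OF d y z, of "gegenbauer d l ^ q" l] zonal_integral_cong[of y e] e y
  by (simp add: mult.commute)

text \<open>The vertex \<open>x1\<close> is integrated out. An edge at \<open>x1\<close> with
  exponent 1 serves as the convolution kernel, and the result is one more factor on the edge from
  \<open>x2\<close> to \<open>x3\<close>.\<close>

lemma gegenbauer_triangle_integral:
  fixes e :: "'a::euclidean_space"
  assumes d: "2 \<le> d" "DIM('a) = d + 1" and e: "norm e = 1" and ab: "a = 1 \<or> b = 1"
  defines "\<sigma> \<equiv> surface_measure :: 'a measure"
    and "G \<equiv> (\<lambda>l x y. poly (gegenbauer d l) ((x :: 'a) \<bullet> y))"
  shows "(LINT (x1, x2, x3)|(\<sigma> \<Otimes>\<^sub>M \<sigma> \<Otimes>\<^sub>M \<sigma>). G l x1 x2 ^ a * G l x1 x3 ^ b * G l x2 x3 ^ c)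
    = zonal_integral e (gegenbauer d l ^ (a + b)) *
      (LINT (x, y)|(\<sigma> \<Otimes>\<^sub>M \<sigma>). G l x y ^ (c + 1))"
proof -
  let ?C = "zonal_integral e (gegenbauer d l ^ (a + b))"
  let ?f = "\<lambda>(x1, x2, x3). G l x1 x2 ^ a * G l x1 x3 ^ b * G l x2 x3 ^ c"
  note c1 = compact_finite_borel_surface_measure[where 'a='a, folded \<sigma>_def]
  note c2 = compact_finite_borel_pair[OF c1 c1]
  have f: "continuous_on UNIV ?f"
    unfolding case_prod_beta G_def by (intro continuous_intros)
  have "integral\<^sup>L (\<sigma> \<Otimes>\<^sub>M \<sigma> \<Otimes>\<^sub>M \<sigma>) ?f = (LINT w|(\<sigma> \<Otimes>\<^sub>M \<sigma>). LINT x|\<sigma>. ?f (x, w))"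
    by (rule integral_pair_continuous(1)[OF c1 c2 f])
  also have "\<dots> = (LINT w|(\<sigma> \<Otimes>\<^sub>M \<sigma>). ?C * (case w of (x, y) \<Rightarrow> G l x y ^ (c + 1)))"
  proof (rule Bochner_Integration.integral_cong[OF refl])
    fix w assume w: "w \<in> space (\<sigma> \<Otimes>\<^sub>M \<sigma>)"
    obtain x2 x3 where [simp]: "w = (x2, x3)" by fastforce
    have n: "norm x2 = 1" "norm x3 = 1"
      using w by (simp_all add: space_pair_measure \<sigma>_def space_surface_measure)
    show "(LINT x|\<sigma>. ?f (x, w)) = ?C * (case w of (x, y) \<Rightarrow> G l x y ^ (c + 1))"
      \<comment> \<open>The first instance serves \<open>a = 1\<close>, with the power on the edge
        to \<open>x3\<close>; the second serves \<open>b = 1\<close>, with the power on the edge to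
        \<open>x2\<close>.\<close>
      using gegenbauer_convolution[OF d e n(2,1), of l b "G l x2 x3 ^ c"]
        gegenbauer_convolution[OF d e n, of l a "G l x2 x3 ^ c"] ab
      by (auto simp: G_def \<sigma>_def inner_commute[of x3 x2] mult_ac)
  qed
  finally show ?thesis by simp
qed

text \<open>Integrating out the corner \<open>x1\<close> replaces its two edges by one more factor
  on the diagonal from \<open>x2\<close> to \<open>x4\<close>, which leaves a triangle.\<close>

lemma gegenbauer_square_integral:
  fixes e :: "'a::euclidean_space"
  assumes d: "2 \<le> d" "DIM('a) = d + 1" and e: "norm e = 1"
  defines "\<sigma> \<equiv> surface_measure :: 'a measure"
    and "G \<equiv> (\<lambda>l x y. poly (gegenbauer d l) ((x :: 'a) \<bullet> y))"
  shows "(LINT (x1, x2, x3, x4)|(\<sigma> \<Otimes>\<^sub>M \<sigma> \<Otimes>\<^sub>M \<sigma> \<Otimes>\<^sub>M \<sigma>).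
      G l x1 x2 * G l x1 x4 ^ q1 * G l x2 x3 ^ q2 * G l x2 x4 ^ q3 * G l x3 x4 ^ q4)
    = zonal_integral e (gegenbauer d l ^ (q1 + 1)) *
      (LINT (x2, x3, x4)|(\<sigma> \<Otimes>\<^sub>M \<sigma> \<Otimes>\<^sub>M \<sigma>). G l x2 x3 ^ q2 * G l x2 x4 ^ (q3 + 1) * G l x3 x4 ^ q4)"
proof -
  let ?c = "zonal_integral e (gegenbauer d l ^ (q1 + 1))"
  let ?f = "\<lambda>(x1, x2, x3, x4). G l x1 x2 * G l x1 x4 ^ q1 * G l x2 x3 ^ q2 * G l x2 x4 ^ q3 * G l x3 x4 ^ q4"
  let ?g = "\<lambda>(x2, x3, x4). G l x2 x3 ^ q2 * G l x2 x4 ^ (q3 + 1) * G l x3 x4 ^ q4"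
  note c1 = compact_finite_borel_surface_measure[where 'a='a, folded \<sigma>_def]
  note c2 = compact_finite_borel_pair[OF c1 c1]
  note c3 = compact_finite_borel_pair[OF c1 c2]
  have f: "continuous_on UNIV ?f"
    unfolding case_prod_beta G_def by (intro continuous_intros)
  have "integral\<^sup>L (\<sigma> \<Otimes>\<^sub>M \<sigma> \<Otimes>\<^sub>M \<sigma> \<Otimes>\<^sub>M \<sigma>) ?f = (LINT w|(\<sigma> \<Otimes>\<^sub>M \<sigma> \<Otimes>\<^sub>M \<sigma>). LINT x|\<sigma>. ?f (x, w))"
    by (rule integral_pair_continuous(1)[OF c1 c3 f])
  also have "\<dots> = (LINT w|(\<sigma> \<Otimes>\<^sub>M \<sigma> \<Otimes>\<^sub>M \<sigma>). ?c * ?g w)"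
  proof (rule Bochner_Integration.integral_cong[OF refl])
    fix w assume w: "w \<in> space (\<sigma> \<Otimes>\<^sub>M \<sigma> \<Otimes>\<^sub>M \<sigma>)"
    obtain x2 x3 x4 where [simp]: "w = (x2, x3, x4)" by (metis surj_pair)
    have n: "norm x2 = 1" "norm x4 = 1"
      using w by (simp_all add: space_pair_measure \<sigma>_def space_surface_measure)
    show "(LINT x|\<sigma>. ?f (x, w)) = ?c * ?g w"
      using gegenbauer_convolution[OF d e n(2,1), of l q1 "G l x2 x3 ^ q2 * G l x2 x4 ^ q3 * G l x3 x4 ^ q4"]
      by (simp add: G_def \<sigma>_def inner_commute[of x4 x2] mult_ac)
  qed
  finally show ?thesis by simp
qed

text \<open>The kernel is now the edge from \<open>x3\<close> to \<open>x4\<close>, so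
  \<open>x3\<close> is the vertex to integrate out.\<close>

lemma gegenbauer_triangle_integral':
  fixes e :: "'a::euclidean_space"
  assumes d: "2 \<le> d" "DIM('a) = d + 1" and e: "norm e = 1"
  defines "\<sigma> \<equiv> surface_measure :: 'a measure"
    and "G \<equiv> (\<lambda>l x y. poly (gegenbauer d l) ((x :: 'a) \<bullet> y))"
  shows "(LINT (x2, x3, x4)|(\<sigma> \<Otimes>\<^sub>M \<sigma> \<Otimes>\<^sub>M \<sigma>). G l x2 x3 ^ q2 * G l x2 x4 ^ q3 * G l x3 x4)
    = zonal_integral e (gegenbauer d l ^ (q2 + 1)) *
      (LINT (x, y)|(\<sigma> \<Otimes>\<^sub>M \<sigma>). G l x y ^ (q3 + 1))"
proof -
  let ?c = "zonal_integral e (gegenbauer d l ^ (q2 + 1))"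
  let ?f = "\<lambda>(x2, x3, x4). G l x2 x3 ^ q2 * G l x2 x4 ^ q3 * G l x3 x4"
  let ?h = "\<lambda>(x, y). G l x y ^ (q3 + 1)"
  note c1 = compact_finite_borel_surface_measure[where 'a='a, folded \<sigma>_def]
  note c2 = compact_finite_borel_pair[OF c1 c1]
  have f: "continuous_on UNIV ?f" and h: "continuous_on UNIV ?h"
    unfolding case_prod_beta G_def by (intro continuous_intros)+
  have fx: "continuous_on UNIV (\<lambda>w. ?f (x2, w))" for x2
    unfolding case_prod_beta G_def by (intro continuous_intros)
  have "integral\<^sup>L (\<sigma> \<Otimes>\<^sub>M \<sigma> \<Otimes>\<^sub>M \<sigma>) ?f = (LINT x2|\<sigma>. LINT w|(\<sigma> \<Otimes>\<^sub>M \<sigma>). ?f (x2, w))"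
    by (rule integral_pair_continuous(2)[OF c1 c2 f])
  \<comment> \<open>Fubini on the inner pair makes \<open>x3\<close> the innermost variable.\<close>
  also have "\<dots> = (LINT x2|\<sigma>. LINT x4|\<sigma>. LINT x3|\<sigma>. ?f (x2, x3, x4))"
    by (simp only: integral_pair_continuous(1)[OF c1 c1 fx])
  also have "\<dots> = (LINT x2|\<sigma>. LINT x4|\<sigma>. ?c * ?h (x2, x4))"
  proof (intro Bochner_Integration.integral_cong refl)
    fix x2 x4 assume "x2 \<in> space \<sigma>" "x4 \<in> space \<sigma>"
    then have n: "norm x2 = 1" "norm x4 = 1"
      by (simp_all add: \<sigma>_def space_surface_measure)
    show "(LINT x3|\<sigma>. ?f (x2, x3, x4)) = ?c * ?h (x2, x4)"
      using gegenbauer_convolution[OF d e n, of l q2 "G l x2 x4 ^ q3"]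
      by (simp add: G_def \<sigma>_def inner_commute[of x2] mult_ac)
  qed
  also have "\<dots> = ?c * integral\<^sup>L (\<sigma> \<Otimes>\<^sub>M \<sigma>) ?h"
    by (simp only: integral_pair_continuous(2)[OF c1 c1 h] integral_mult_right_zero)
  finally show ?thesis .
qed

theorem lemma3p1p13:
  fixes d :: nat
  assumes "d \<ge> 2" and "CARD('n::finite) = d + 1"
  shows "\<exists>c1 c2 c3 :: real. c1 > 0 \<and> c2 > 0 \<and> c3 > 0 \<and> (\<forall>l\<ge>1.
    let \<sigma> = surface_measure :: (real ^ 'n) measure;
        G = (\<lambda>(x :: real ^ 'n) y. poly (gegenbauer d l) (x \<bullet> y))
    in
      (\<forall>q1\<ge>2. \<forall>q2\<ge>2.
        (LINT (x1, x2, x3)|(\<sigma> \<Otimes>\<^sub>M \<sigma> \<Otimes>\<^sub>M \<sigma>). G x1 x2 * G x1 x3 ^ q1 * G x2 x3 ^ q2)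
        = c1 * (LINT (x, y)|(\<sigma> \<Otimes>\<^sub>M \<sigma>). G x y ^ (q1 + 1))
             * (LINT (x, y)|(\<sigma> \<Otimes>\<^sub>M \<sigma>). G x y ^ (q2 + 1))) \<and>
      (\<forall>q1\<ge>2. \<forall>q2\<ge>2. \<forall>q3\<ge>1.
        (LINT (x1, x2, x3, x4)|(\<sigma> \<Otimes>\<^sub>M \<sigma> \<Otimes>\<^sub>M \<sigma> \<Otimes>\<^sub>M \<sigma>).
           G x1 x2 * G x1 x4 ^ q1 * G x2 x3 ^ q2 * G x3 x4 ^ q3)
        = c2 * (LINT (x, y)|(\<sigma> \<Otimes>\<^sub>M \<sigma>). G x y ^ (q1 + 1))
             * (LINT (x, y)|(\<sigma> \<Otimes>\<^sub>M \<sigma>). G x y ^ (q2 + 1))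
             * (LINT (x, y)|(\<sigma> \<Otimes>\<^sub>M \<sigma>). G x y ^ (q3 + 1))) \<and>
      (\<forall>q1\<ge>2. \<forall>q2\<ge>2. \<forall>q3\<ge>0.
        (LINT (x1, x2, x3, x4)|(\<sigma> \<Otimes>\<^sub>M \<sigma> \<Otimes>\<^sub>M \<sigma> \<Otimes>\<^sub>M \<sigma>).
           G x1 x2 * G x1 x4 ^ q1 * G x2 x3 ^ q2 * G x2 x4 ^ q3 * G x3 x4)
        = c3 * (LINT (x, y)|(\<sigma> \<Otimes>\<^sub>M \<sigma>). G x y ^ (q1 + 1))
             * (LINT (x, y)|(\<sigma> \<Otimes>\<^sub>M \<sigma>). G x y ^ (q2 + 1))
             * (LINT (x, y)|(\<sigma> \<Otimes>\<^sub>M \<sigma>). G x y ^ (q3 + 2))))"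
proof -
  have d: "2 \<le> d" "DIM(real ^ 'n) = d + 1"
    using assms by simp_all
  obtain e :: "real ^ 'n" where "e \<in> Basis" using nonempty_Basis by blast
  then have e: "norm e = 1" by simp
  define \<mu> where "\<mu> = zonal_integral e 1"
  have \<mu>: "\<mu> > 0"
    using unit_ball_vol_pos[of "real DIM(real ^ 'n)"] DIM_positive[where 'a="real ^ 'n"]
    unfolding \<mu>_def zonal_integral_1 by (intro mult_pos_pos) simp_all
  let ?S = "surface_measure :: (real ^ 'n) measure"
  let ?Z = "\<lambda>l q. zonal_integral e (gegenbauer d l ^ q)"
  have I: "(LINT (x, y)|(?S \<Otimes>\<^sub>M ?S). poly (gegenbauer d l) (x \<bullet> y) ^ q) = \<mu> * ?Z l q" for l q
    using zonal_integral_pair[OF e, of "gegenbauer d l ^ q"] by (simp add: \<mu>_def)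
  \<comment> \<open>Each double integral is \<open>\<mu>\<close> times a zonal integral. Integrating
    out one vertex leaves one zonal factor and one double integral, hence \<open>1 / \<mu>\<close>;
    integrating out two leaves two zonal factors, hence \<open>1 / \<mu>^2\<close>.\<close>
  show ?thesis
  proof (rule exI[of _ "1 / \<mu>"], rule exI[of _ "1 / \<mu>\<^sup>2"], rule exI[of _ "1 / \<mu>\<^sup>2"],
      unfold Let_def, intro conjI allI impI)
    fix l q1 q2 :: nat
    show "(LINT (x1, x2, x3)|(?S \<Otimes>\<^sub>M ?S \<Otimes>\<^sub>M ?S).
          poly (gegenbauer d l) (x1 \<bullet> x2) * poly (gegenbauer d l) (x1 \<bullet> x3) ^ q1 *
          poly (gegenbauer d l) (x2 \<bullet> x3) ^ q2)
        = 1 / \<mu> * (LINT (x, y)|(?S \<Otimes>\<^sub>M ?S). poly (gegenbauer d l) (x \<bullet> y) ^ (q1 + 1))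
             * (LINT (x, y)|(?S \<Otimes>\<^sub>M ?S). poly (gegenbauer d l) (x \<bullet> y) ^ (q2 + 1))"
      unfolding I using gegenbauer_triangle_integral[OF d e, of 1 q1 l q2, unfolded I] \<mu> by simp
    fix q3 :: nat
    show "(LINT (x1, x2, x3, x4)|(?S \<Otimes>\<^sub>M ?S \<Otimes>\<^sub>M ?S \<Otimes>\<^sub>M ?S).
          poly (gegenbauer d l) (x1 \<bullet> x2) * poly (gegenbauer d l) (x1 \<bullet> x4) ^ q1 *
          poly (gegenbauer d l) (x2 \<bullet> x3) ^ q2 * poly (gegenbauer d l) (x3 \<bullet> x4) ^ q3)
        = 1 / \<mu>\<^sup>2 * (LINT (x, y)|(?S \<Otimes>\<^sub>M ?S). poly (gegenbauer d l) (x \<bullet> y) ^ (q1 + 1))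
             * (LINT (x, y)|(?S \<Otimes>\<^sub>M ?S). poly (gegenbauer d l) (x \<bullet> y) ^ (q2 + 1))
             * (LINT (x, y)|(?S \<Otimes>\<^sub>M ?S). poly (gegenbauer d l) (x \<bullet> y) ^ (q3 + 1))"
      unfolding I
      \<comment> \<open>The square starts without a diagonal, so the remaining triangle has a
        diagonal of exponent 1, which is the kernel for integrating out \<open>x2\<close>.\<close>
      using gegenbauer_square_integral[OF d e, of l q1 q2 0 q3]
        gegenbauer_triangle_integral[OF d e, of q2 1 l q3, unfolded I] \<mu>
      by (simp add: power2_eq_square)
    show "(LINT (x1, x2, x3, x4)|(?S \<Otimes>\<^sub>M ?S \<Otimes>\<^sub>M ?S \<Otimes>\<^sub>M ?S).
          poly (gegenbauer d l) (x1 \<bullet> x2) * poly (gegenbauer d l) (x1 \<bullet> x4) ^ q1 *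
          poly (gegenbauer d l) (x2 \<bullet> x3) ^ q2 * poly (gegenbauer d l) (x2 \<bullet> x4) ^ q3 *
          poly (gegenbauer d l) (x3 \<bullet> x4))
        = 1 / \<mu>\<^sup>2 * (LINT (x, y)|(?S \<Otimes>\<^sub>M ?S). poly (gegenbauer d l) (x \<bullet> y) ^ (q1 + 1))
             * (LINT (x, y)|(?S \<Otimes>\<^sub>M ?S). poly (gegenbauer d l) (x \<bullet> y) ^ (q2 + 1))
             * (LINT (x, y)|(?S \<Otimes>\<^sub>M ?S). poly (gegenbauer d l) (x \<bullet> y) ^ (q3 + 2))"
      unfolding I
      \<comment> \<open>The diagonal gains one factor from \<open>x1\<close> and one from
        \<open>x3\<close>, which gives the exponent \<open>q3 + 2\<close>.\<close>
      using gegenbauer_square_integral[OF d e, of l q1 q2 q3 1]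
        gegenbauer_triangle_integral'[OF d e, of l q2 "q3 + 1", unfolded I] \<mu>
      by (simp add: power2_eq_square)
  qed (use \<mu> in simp_all)
qed

end
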